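(* Let $\mathfrak{L}$ be a finite-dimensional left Leibniz algebra over an algebraically closed field $\mathbb{F}$. If $\mathfrak{I}$ is an ideal of $\mathfrak{L}$ such that $\mathfrak{I}\subseteq F(\mathfrak{L})$ and $\mathfrak{L}/\mathfrak{I}$ is supersolvable, then $\mathfrak{L}$ is supersolvable.
   Context: A left Leibniz algebra over a field $\mathbb{F}$ is an $\mathbb{F}$-vector space $\mathfrak{L}$ with a bilinear multiplication satisfying $x(yz)=(xy)z+y(xz)$ for all $x,y,z\in\mathfrak{L}$. Ideals are two-sided. $\mathfrak{L}$ is supersolvable if there is a chain $\mathfrak{L}=\mathfrak{L}_k\supset\mathfrak{L}_{k-1}\supset\cdots\supset\mathfrak{L}_1\supset\mathfrak{L}_0=0$ of ideals of $\mathfrak{L}$ with $\dim_{\mathbb{F}}\mathfrak{L}_j/\mathfrak{L}_{j-1}=1$ for $1\le j\le k$. The Frattini subalgebra $F(\mathfrak{L})$ is the intersection of the maximal (proper) subalgebras of $\mathfrak{L}$. *)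

theory Defs
  imports "Jordan_Normal_Form.VS_Connect" "HOL-Algebra.QuotRing"
begin

text \<open>
  The ground field is the type \<open>'k\<close>, viewed as an HOL-Algebra ring by \<open>class_ring\<close>. An algebra over
  it is a \<open>module\<close> record, whose inherited field \<open>mult\<close> is the product of the algebra. The product
  need be neither associative nor unital; the record field \<open>one\<close> carries no meaning.
\<close>

locale leibniz_algebra =
  vectorspace "class_ring :: 'k::field ring" L
  for L :: "('k::field, 'a) module" (structure) +
  assumes mult_closed:
      "\<lbrakk>x \<in> carrier L; y \<in> carrier L\<rbrakk> \<Longrightarrow> x \<otimes> y \<in> carrier L"
    and mult_add_left:
      "\<lbrakk>x \<in> carrier L; y \<in> carrier L; z \<in> carrier L\<rbrakk> \<Longrightarrow> (x \<oplus> y) \<otimes> z = x \<otimes> z \<oplus> y \<otimes> z"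
    and mult_add_right:
      "\<lbrakk>x \<in> carrier L; y \<in> carrier L; z \<in> carrier L\<rbrakk> \<Longrightarrow> x \<otimes> (y \<oplus> z) = x \<otimes> y \<oplus> x \<otimes> z"
    and mult_smult_left:
      "\<lbrakk>x \<in> carrier L; y \<in> carrier L\<rbrakk> \<Longrightarrow> (c \<odot> x) \<otimes> y = c \<odot> (x \<otimes> y)"
    and mult_smult_right:
      "\<lbrakk>x \<in> carrier L; y \<in> carrier L\<rbrakk> \<Longrightarrow> x \<otimes> (c \<odot> y) = c \<odot> (x \<otimes> y)"
    and left_leibniz:
      "\<lbrakk>x \<in> carrier L; y \<in> carrier L; z \<in> carrier L\<rbrakk> \<Longrightarrow>
        x \<otimes> (y \<otimes> z) = (x \<otimes> y) \<otimes> z \<oplus> y \<otimes> (x \<otimes> z)"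

definition leibniz_subalgebra :: "'a set \<Rightarrow> ('k::field, 'a) module \<Rightarrow> bool" where
  "leibniz_subalgebra S L \<longleftrightarrow>
     VectorSpace.subspace class_ring S L \<and> (\<forall>x\<in>S. \<forall>y\<in>S. x \<otimes>\<^bsub>L\<^esub> y \<in> S)"

definition leibniz_ideal :: "'a set \<Rightarrow> ('k::field, 'a) module \<Rightarrow> bool" where
  "leibniz_ideal I L \<longleftrightarrow>
     VectorSpace.subspace class_ring I L \<and>
     (\<forall>x\<in>carrier L. \<forall>y\<in>I. x \<otimes>\<^bsub>L\<^esub> y \<in> I \<and> y \<otimes>\<^bsub>L\<^esub> x \<in> I)"

definition maximal_subalgebra :: "'a set \<Rightarrow> ('k::field, 'a) module \<Rightarrow> bool" where
  "maximal_subalgebra M L \<longleftrightarrow>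
     leibniz_subalgebra M L \<and> M \<noteq> carrier L \<and>
     (\<forall>S. leibniz_subalgebra S L \<and> M \<subseteq> S \<longrightarrow> S = M \<or> S = carrier L)"

text \<open>
  The intersection is taken inside \<open>carrier L\<close>, so that it is \<open>carrier L\<close> when there are no maximal
  subalgebras.
\<close>
definition frattini :: "('k::field, 'a) module \<Rightarrow> 'a set" where
  "frattini L = carrier L \<inter> \<Inter>{M. maximal_subalgebra M L}"

text \<open>
  The quotient has the additive cosets of \<open>I\<close> as elements; apart from \<open>smult\<close> the fields are those
  of the library's quotient ring \<open>L Quot I\<close>.
\<close>
definition leibniz_quot :: "('k::field, 'a) module \<Rightarrow> 'a set \<Rightarrow> ('k, 'a set) module" where
  "leibniz_quot L I =
     \<lparr>carrier = a_rcosets\<^bsub>L\<^esub> I,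
      mult = rcoset_mult L I,
      one = I +>\<^bsub>L\<^esub> \<one>\<^bsub>L\<^esub>,
      zero = I,
      add = set_add L,
      smult = (\<lambda>c A. \<Union>x\<in>A. I +>\<^bsub>L\<^esub> (c \<odot>\<^bsub>L\<^esub> x))\<rparr>"

text \<open>
  The factor \<open>C (Suc j) / C j\<close> is the quotient of the subalgebra \<open>L\<lparr>carrier := C (Suc j)\<rparr>\<close>.
  Finite-dimensionality is stated next to the dimension because \<open>vectorspace.dim\<close> is a \<open>LEAST\<close>,
  with no specified value on spaces that are not finitely generated.
\<close>
definition supersolvable :: "('k::field, 'a) module \<Rightarrow> bool" where
  "supersolvable L \<longleftrightarrow>
     (\<exists>(k::nat) C. C 0 = {\<zero>\<^bsub>L\<^esub>} \<and> C k = carrier L \<and>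
        (\<forall>j\<le>k. leibniz_ideal (C j) L) \<and>
        (\<forall>j<k. C j \<subset> C (Suc j) \<and>
           vectorspace.fin_dim class_ring (leibniz_quot (L\<lparr>carrier := C (Suc j)\<rparr>) (C j)) \<and>
           vectorspace.dim class_ring (leibniz_quot (L\<lparr>carrier := C (Suc j)\<rparr>) (C j)) = 1))"

end

theory Submission
  imports Defs
begin

text \<open>
  Let \<open>I = D\<^sub>0 \<subset> \<dots> \<subset> D\<^sub>k = L\<close> be the preimage of the flag of \<open>L/I\<close>, and let \<open>N\<close> be the set of \<open>x\<close> with
  \<open>x D\<^sub>j\<^sub>+\<^sub>1 \<subseteq> D\<^sub>j\<close> for all \<open>j\<close>. Since \<open>L\<close> acts by scalars on the factors, \<open>N\<close> contains all products. Left
  multiplication by \<open>b \<in> N\<close> is a derivation that is nilpotent modulo \<open>I\<close>, so its Fitting null component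
  is a subalgebra which together with \<open>I\<close> spans \<open>L\<close>; as \<open>I\<close> lies in every maximal subalgebra, the null
  component is all of \<open>L\<close>. Hence \<open>N\<close> acts nilpotently on \<open>L\<close>. For an ideal \<open>J \<subset> I\<close>, Engel's theorem gives
  a nonzero space of vectors of \<open>I/J\<close> killed by \<open>N\<close>; there \<open>L\<close> acts by commuting operators, which have
  a common eigenvector \<open>u\<close>. Right multiplications are controlled because \<open>xu + ux\<close> annihilates \<open>L\<close> from
  the left. So \<open>J + \<langle>u\<rangle>\<close> is an ideal, and a flag of ideals can be built from \<open>0\<close> up to \<open>I\<close>. The characteristic
  plays no role.
\<close>

section \<open>Subspaces of finite-dimensional vector spaces\<close>

text \<open>Take for \<open>d S\<close> the largest size of a linearly independent subset of
  \<open>S\<close>: a vector of \<open>T\<close> outside \<open>S\<close> enlarges such a subset.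
  The function serves to pick maximal and minimal subspaces.\<close>

lemma (in vectorspace) strict_mono_dimension:
  assumes fd: fin_dim
  obtains d :: "'c set \<Rightarrow> nat" where "\<And>S. d S \<le> dim"
    and "\<And>S T. \<lbrakk>VectorSpace.subspace K S V; VectorSpace.subspace K T V; S \<subset> T\<rbrakk> \<Longrightarrow> d S < d T"
proof -
  define P where "P S A \<longleftrightarrow> finite A \<and> A \<subseteq> S \<and> A \<subseteq> carrier V \<and> lin_indpt A" for S A
  define d where "d S = Max (card ` {A. P S A})" for S
  have le: "card A \<le> dim" if "P S A" for S A
    using that li_le_dim[OF fd] by (auto simp: P_def)
  have fin: "finite (card ` {A. P S A})" for S
    by (rule finite_subset[of _ "{..dim}"]) (auto simp: le)
  have "lin_indpt {}"
    by (auto simp: lin_dep_def)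
  then have ne: "card ` {A. P S A} \<noteq> {}" for S
    by (auto simp: P_def)
  show thesis
  proof
    show "d S \<le> dim" for S
      unfolding d_def using fin ne le by (subst Max_le_iff) auto
    show "d S < d T"
      if S: "VectorSpace.subspace K S V" and T: "VectorSpace.subspace K T V" and ST: "S \<subset> T" for S T
    proof -
      have "d S \<in> card ` {A. P S A}"
        unfolding d_def by (rule Max_in[OF fin ne])
      then obtain A where A: "P S A" "d S = card A"
        by auto
      obtain v where v: "v \<in> T" "v \<notin> S"
        using ST by auto
      have "submodule K S V" "submodule K T V"
        using S T by auto
      then have "span A \<subseteq> S" "T \<subseteq> carrier V"
        using span_is_subset[of A S] A by (auto simp: P_def submodule_def)
      then have vA: "v \<notin> span A" "v \<notin> A" "v \<in> carrier V"
        using v A by (auto simp: P_def)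
      then have "lin_indpt (A \<union> {v})"
        using lin_dep_iff_in_span[of A v] A by (auto simp: P_def)
      then have "P T (A \<union> {v})"
        using A v vA ST by (auto simp: P_def)
      then have "card (A \<union> {v}) \<le> d T"
        unfolding d_def by (intro Max_ge fin) auto
      then show ?thesis
        using A vA by (auto simp: P_def)
    qed
  qed
qed

text \<open>A member with the largest value of \<open>d\<close> has no proper extension in the
  family. This lemma and its dual replace the inductions on dimension in the arguments
  below.\<close>

lemma (in vectorspace) maximal_subspace_exists:
  assumes fin_dim and "\<And>S. Q S \<Longrightarrow> VectorSpace.subspace K S V" and "Q S0"
  obtains S where "Q S" "\<And>T. Q T \<Longrightarrow> S \<subseteq> T \<Longrightarrow> T = S"
proof -
  obtain d :: "'c set \<Rightarrow> nat" where d: "\<And>S. d S \<le> dim"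
    "\<And>S T. \<lbrakk>VectorSpace.subspace K S V; VectorSpace.subspace K T V; S \<subset> T\<rbrakk> \<Longrightarrow> d S < d T"
    using strict_mono_dimension[OF assms(1)] by blast
  obtain S where S: "Q S" "\<And>T. Q T \<Longrightarrow> d T \<le> d S"
    using ex_has_greatest_nat[of Q S0 d "Suc dim"] assms(3) d(1) by (auto simp: less_Suc_eq_le)
  show thesis
  proof
    show "Q S" by fact
    show "T = S" if "Q T" "S \<subseteq> T" for T
      using d(2)[of S T] S that assms(2) by (metis leD psubsetI)
  qed
qed

lemma (in vectorspace) minimal_subspace_exists:
  assumes fin_dim and "\<And>S. Q S \<Longrightarrow> VectorSpace.subspace K S V" and "Q S0"
  obtains S where "Q S" "\<And>T. Q T \<Longrightarrow> T \<subseteq> S \<Longrightarrow> T = S"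
proof -
  obtain d :: "'c set \<Rightarrow> nat" where d: "\<And>S. d S \<le> dim"
    "\<And>S T. \<lbrakk>VectorSpace.subspace K S V; VectorSpace.subspace K T V; S \<subset> T\<rbrakk> \<Longrightarrow> d S < d T"
    using strict_mono_dimension[OF assms(1)] by blast
  obtain S where S: "Q S" "\<And>T. Q T \<Longrightarrow> d S \<le> d T"
    using ex_has_least_nat[of Q S0 d] assms(3) by auto
  show thesis
  proof
    show "Q S" by fact
    show "T = S" if "Q T" "T \<subseteq> S" for T
      using d(2)[of T S] S that assms(2) by (metis leD psubsetI)
  qed
qed

lemma subspace_iff:
  assumes "vectorspace (class_ring :: 'k::field ring) (V :: ('k, 'a) module)"
  shows "VectorSpace.subspace class_ring S V \<longleftrightarrow>
    S \<subseteq> carrier V \<and> \<zero>\<^bsub>V\<^esub> \<in> S \<and> (\<forall>x\<in>S. \<forall>y\<in>S. x \<oplus>\<^bsub>V\<^esub> y \<in> S) \<and> (\<forall>c. \<forall>x\<in>S. c \<odot>\<^bsub>V\<^esub> x \<in> S)"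
proof -
  interpret vectorspace "class_ring :: 'k ring" V by fact
  show ?thesis
    using assms module_axioms by (auto simp: VectorSpace.subspace_def submodule_def)
qed

text \<open>Turns the two conditions that \<open>supersolvable\<close> puts on a factor into the
  existence of a generator, so that later arguments can avoid bases and \<open>dim\<close>.\<close>

lemma (in vectorspace) dim_one_iff:
  "fin_dim \<and> dim = 1 \<longleftrightarrow>
     (\<exists>u\<in>carrier V. u \<noteq> \<zero>\<^bsub>V\<^esub> \<and> carrier V = {c \<odot>\<^bsub>V\<^esub> u |c. c \<in> carrier K})"
proof -
  have span_single: "span {u} = {c \<odot>\<^bsub>V\<^esub> u |c. c \<in> carrier K}" if "u \<in> carrier V" for u
  proof -
    have lc: "lincomb a {u} = a u \<odot>\<^bsub>V\<^esub> u" if "a \<in> {u} \<rightarrow> carrier K" for a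
      using \<open>u \<in> carrier V\<close> that by (simp add: lincomb_def)
    have sp: "span {u} = {lincomb a {u} |a. a \<in> {u} \<rightarrow> carrier K}"
      by (rule finite_span) (use that in auto)
    show ?thesis
    proof (intro equalityI subsetI)
      fix x assume "x \<in> span {u}"
      then show "x \<in> {c \<odot>\<^bsub>V\<^esub> u |c. c \<in> carrier K}"
        unfolding sp using lc by blast
    next
      fix x assume "x \<in> {c \<odot>\<^bsub>V\<^esub> u |c. c \<in> carrier K}"
      then obtain c where c: "c \<in> carrier K" "x = c \<odot>\<^bsub>V\<^esub> u"
        by auto
      then have "x = lincomb (\<lambda>_. c) {u}" "(\<lambda>_. c) \<in> {u} \<rightarrow> carrier K"
        using lc[of "\<lambda>_. c"] by auto
      then show "x \<in> span {u}"
        unfolding sp by blast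
    qed
  qed
  show ?thesis
  proof
    assume *: "fin_dim \<and> dim = 1"
    then obtain B where B: "finite B" "basis B"
      using finite_basis_exists by auto
    then have "card B = 1"
      using dim_basis * by auto
    then obtain u where u: "B = {u}"
      by (auto simp: card_1_singleton_iff)
    have uV: "u \<in> carrier V" and gen: "span {u} = carrier V" and li: "lin_indpt {u}"
      using B(2) unfolding basis_def u by blast+
    have "u \<noteq> \<zero>\<^bsub>V\<^esub>"
      using vs_zero_lin_dep[of "{u}"] li uV by blast
    then show "\<exists>u\<in>carrier V. u \<noteq> \<zero>\<^bsub>V\<^esub> \<and> carrier V = {c \<odot>\<^bsub>V\<^esub> u |c. c \<in> carrier K}"
      using uV gen span_single[OF uV] by blast
  next
    assume "\<exists>u\<in>carrier V. u \<noteq> \<zero>\<^bsub>V\<^esub> \<and> carrier V = {c \<odot>\<^bsub>V\<^esub> u |c. c \<in> carrier K}"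
    then obtain u where u: "u \<in> carrier V" "u \<noteq> \<zero>\<^bsub>V\<^esub>" "carrier V = {c \<odot>\<^bsub>V\<^esub> u |c. c \<in> carrier K}"
      by blast
    have gen: "span {u} = carrier V"
      using span_single[OF u(1)] u(3)[symmetric] by (rule trans)
    have "lin_indpt {}"
      by (auto simp: lin_dep_def)
    moreover have "u \<notin> span {}"
      using u(2) unfolding span_empty by blast
    ultimately have "lin_indpt {u}"
      using lin_dep_iff_in_span[of "{}" u, OF _ _ u(1)] by simp
    then have "basis {u}"
      using u(1) gen by (simp add: basis_def)
    moreover have fin_dim
      unfolding fin_dim_def using gen u(1) by (intro exI[of _ "{u}"]) blast
    ultimately show "fin_dim \<and> dim = 1"
      using dim_basis[of "{u}"] by simp
  qed
qed

section \<open>Quotients and flags\<close>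

lemma leibniz_quot_simps [simp]:
  "carrier (leibniz_quot L I) = a_rcosets\<^bsub>L\<^esub> I"
  "mult (leibniz_quot L I) = rcoset_mult L I"
  "zero (leibniz_quot L I) = I"
  "add (leibniz_quot L I) = set_add L"
  by (simp_all add: leibniz_quot_def)

text \<open>Built for a bare subspace \<open>W\<close>, so that it covers the factors of a flag as
  well as \<open>L/I\<close>.\<close>

locale quotient_vectorspace = vectorspace "class_ring :: 'k::field ring" V
  for V :: "('k::field, 'a) module" (structure) +
  fixes W :: "'a set"
  assumes subspace: "VectorSpace.subspace class_ring W V"
begin

lemma W_carrier: "x \<in> W \<Longrightarrow> x \<in> carrier V"
  and W_zero: "\<zero> \<in> W"
  and W_add: "x \<in> W \<Longrightarrow> y \<in> W \<Longrightarrow> x \<oplus> y \<in> W"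
  and W_smult: "x \<in> W \<Longrightarrow> c \<odot> x \<in> W"
  using subspace by (auto simp: subspace_iff[OF vectorspace_axioms])

lemma smult_in_carrier: "x \<in> carrier V \<Longrightarrow> c \<odot> x \<in> carrier V"
  by (rule smult_closed) auto

lemma abelian_subgroup: "abelian_subgroup W V"
proof (rule abelian_subgroupI3)
  have "\<ominus> x \<in> W" if "x \<in> W" for x
    using W_smult[OF that, of "-1"] smult_l_minus[of 1 x] smult_one[of x] W_carrier[OF that]
    by (simp add: class_ring_simps)
  then show "additive_subgroup W V"
    by (intro additive_subgroup.intro M.add.subgroupI)
      (auto simp: W_carrier W_add intro: W_zero)
qed (rule M.abelian_group_axioms)

sublocale abelian_subgroup W V
  by (rule abelian_subgroup)

lemma coset_eq_iff_mem:
  assumes "x \<in> carrier V" "y \<in> carrier V"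
  shows "W +> x = W +> y \<longleftrightarrow> x \<in> W +> y"
  using a_rcos_self[OF assms(1)] a_repr_independence'[OF _ assms(2)] by auto

lemma coset_zero: "W +> \<zero> = W"
  using a_rcos_const[OF W_zero] .

lemma coset_eq_W_iff: "x \<in> carrier V \<Longrightarrow> W +> x = W \<longleftrightarrow> x \<in> W"
  using coset_eq_iff_mem[of x \<zero>] coset_zero by simp

lemma cosetE:
  assumes "A \<in> a_rcosets W"
  obtains x where "x \<in> carrier V" "A = W +> x"
  using assms by (auto simp: A_RCOSETS_def')

text \<open>The union in \<open>smult\<close> collapses to one coset: \<open>c (w + v)\<close> and
  \<open>c v\<close> differ by \<open>c w\<close>, which lies in \<open>W\<close>.\<close>

lemma coset_smult:
  assumes v: "v \<in> carrier V"
  shows "c \<odot>\<^bsub>leibniz_quot V W\<^esub> (W +> v) = W +> (c \<odot> v)"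
proof -
  have "W +> (c \<odot> x) = W +> (c \<odot> v)" if x: "x \<in> W +> v" for x
  proof -
    obtain w where w: "w \<in> W" "x = w \<oplus> v"
      using x by (auto simp: a_r_coset_def')
    then have "c \<odot> x = c \<odot> w \<oplus> c \<odot> v"
      using W_carrier v smult_r_distr[of c w v] by auto
    then have "c \<odot> x \<in> W +> (c \<odot> v)"
      using W_smult[OF w(1)] by (auto simp: a_r_coset_def')
    then show ?thesis
      by (rule a_repr_independence'[OF _ smult_in_carrier[OF v], symmetric])
  qed
  then have "(\<Union>x\<in>W +> v. W +> (c \<odot> x)) = (\<Union>x\<in>W +> v. W +> (c \<odot> v))"
    by (intro SUP_cong refl)
  also have "\<dots> = W +> (c \<odot> v)"
    using a_rcos_self[OF v] by auto
  finally show ?thesis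
    by (simp add: leibniz_quot_def)
qed

lemma coset_add:
  "x \<in> carrier V \<Longrightarrow> y \<in> carrier V \<Longrightarrow> (W +> x) <+> (W +> y) = W +> (x \<oplus> y)"
  by (rule a_rcos_sum)

lemma quotient_is_vectorspace: "vectorspace class_ring (leibniz_quot V W)"
proof (rule vs_criteria, goal_cases)
  \<comment> \<open>The numbered goals are those of \<open>vs_criteria\<close>; the axioms for the
    quotient are checked on representatives of the cosets.\<close>
  case 1
  show ?case ..
next
  case 2
  then show ?case
    using coset_zero a_rcosetsI[OF a_subset, of \<zero>] by simp
next
  case 3
  then show ?case
    by (auto elim!: cosetE simp: coset_add intro!: a_rcosetsI a_subset)
next
  case 4
  show ?case
  proof
    fix v assume "v \<in> carrier (leibniz_quot V W)"
    then obtain x where x: "x \<in> carrier V" "v = W +> x"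
      by (auto elim: cosetE)
    then show "\<exists>neg_v\<in>carrier (leibniz_quot V W).
        v \<oplus>\<^bsub>leibniz_quot V W\<^esub> neg_v = \<zero>\<^bsub>leibniz_quot V W\<^esub>"
      by (intro bexI[of _ "W +> (\<ominus> x)"]) (auto simp: coset_add M.r_neg coset_zero a_rcosetsI a_subset)
  qed
next
  case 5
  then show ?case
    by (auto elim!: cosetE simp: coset_smult smult_in_carrier intro!: a_rcosetsI a_subset)
next
  case 6
  then show ?case
    by (auto elim!: cosetE simp: coset_add M.a_comm)
next
  case 7
  then show ?case
    by (auto elim!: cosetE simp: coset_add M.a_assoc)
next
  case 8
  show ?case
  proof
    fix v assume "v \<in> carrier (leibniz_quot V W)"
    then obtain x where x: "x \<in> carrier V" "v = W +> x"
      by (auto elim: cosetE)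
    then show "v \<oplus>\<^bsub>leibniz_quot V W\<^esub> \<zero>\<^bsub>leibniz_quot V W\<^esub> = v"
      using coset_add[of x \<zero>] by (simp add: coset_zero)
  qed
next
  case 9
  then show ?case
    using smult_assoc1
    by (auto elim!: cosetE simp: coset_smult smult_in_carrier)
next
  case 10
  then show ?case
    using smult_one by (auto elim!: cosetE simp: coset_smult)
next
  case 11
  then show ?case
    using smult_l_distr
    by (auto elim!: cosetE simp: coset_smult coset_add smult_in_carrier)
next
  case 12
  then show ?case
    using smult_r_distr
    by (auto elim!: cosetE simp: coset_smult coset_add smult_in_carrier)
qed

text \<open>This is \<open>dim_one_iff\<close> read on representatives:
  \<open>W + v = c (W + u)\<close> says that \<open>v = w + c u\<close> for some
  \<open>w \<in> W\<close>.\<close>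

lemma quotient_dim_one_iff:
  "vectorspace.fin_dim class_ring (leibniz_quot V W) \<and>
     vectorspace.dim class_ring (leibniz_quot V W) = 1 \<longleftrightarrow>
   (\<exists>u\<in>carrier V. u \<notin> W \<and> carrier V = {w \<oplus> c \<odot> u |w c. w \<in> W})" (is "?l \<longleftrightarrow> ?r")
proof -
  let ?Q = "leibniz_quot V W"
  have "?l \<longleftrightarrow> (\<exists>A\<in>carrier ?Q. A \<noteq> \<zero>\<^bsub>?Q\<^esub> \<and>
      carrier ?Q = {c \<odot>\<^bsub>?Q\<^esub> A |c. c \<in> carrier (class_ring :: 'k ring)})"
    by (rule vectorspace.dim_one_iff[OF quotient_is_vectorspace])
  also have "\<dots> \<longleftrightarrow> (\<exists>u\<in>carrier V. W +> u \<noteq> W \<and>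
      carrier ?Q = {c \<odot>\<^bsub>?Q\<^esub> (W +> u) |c. True})"
    by (auto simp: A_RCOSETS_def')
  also have "\<dots> \<longleftrightarrow> ?r"
  proof (rule bex_cong[OF refl])
    fix u assume u: "u \<in> carrier V"
    have "{c \<odot>\<^bsub>?Q\<^esub> (W +> u) |c. True} \<subseteq> carrier ?Q"
      using a_rcosetsI[OF a_subset] smult_in_carrier[OF u] by (auto simp: coset_smult[OF u])
    then have "carrier ?Q = {c \<odot>\<^bsub>?Q\<^esub> (W +> u) |c. True} \<longleftrightarrow>
        carrier ?Q \<subseteq> {c \<odot>\<^bsub>?Q\<^esub> (W +> u) |c. True}"
      by blast
    also have "\<dots> \<longleftrightarrow> (\<forall>v\<in>carrier V. \<exists>c. W +> v = W +> (c \<odot> u))"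
      by (auto simp: coset_smult[OF u] A_RCOSETS_def')
    also have "\<dots> \<longleftrightarrow> (\<forall>v\<in>carrier V. \<exists>c. v \<in> W +> (c \<odot> u))"
      using coset_eq_iff_mem smult_in_carrier[OF u] by simp
    also have "\<dots> \<longleftrightarrow> carrier V = {w \<oplus> c \<odot> u |w c. w \<in> W}"
      using W_carrier smult_in_carrier[OF u] by (auto simp: a_r_coset_def') blast+
    finally show "W +> u \<noteq> W \<and> carrier ?Q = {c \<odot>\<^bsub>?Q\<^esub> (W +> u) |c. True} \<longleftrightarrow>
        u \<notin> W \<and> carrier V = {w \<oplus> c \<odot> u |w c. w \<in> W}"
      using coset_eq_W_iff[OF u] by simp
  qed
  finally show ?thesis .
qed

end

lemma factor_dim_one_iff:
  fixes V :: "('k::field, 'a) module" (structure)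
  assumes V: "vectorspace class_ring V"
    and J: "VectorSpace.subspace class_ring J V" and S: "VectorSpace.subspace class_ring S V"
    and "J \<subseteq> S"
  shows "vectorspace.fin_dim class_ring (leibniz_quot (V\<lparr>carrier := S\<rparr>) J) \<and>
     vectorspace.dim class_ring (leibniz_quot (V\<lparr>carrier := S\<rparr>) J) = 1 \<longleftrightarrow>
   (\<exists>u\<in>S. u \<notin> J \<and> S = {j \<oplus> c \<odot> u |j c. j \<in> J})"
proof -
  have VS: "vectorspace class_ring (V\<lparr>carrier := S\<rparr>)"
    by (rule vectorspace.subspace_is_vs[OF V S])
  have "VectorSpace.subspace class_ring J (V\<lparr>carrier := S\<rparr>)"
    using J \<open>J \<subseteq> S\<close> by (auto simp: subspace_iff[OF VS] subspace_iff[OF V])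
  then interpret quotient_vectorspace "V\<lparr>carrier := S\<rparr>" J
    using VS by (simp add: quotient_vectorspace_def quotient_vectorspace_axioms_def)
  show ?thesis
    using quotient_dim_one_iff by simp
qed

lemma supersolvable_iff:
  fixes V :: "('k::field, 'a) module" (structure)
  assumes V: "vectorspace class_ring V"
  shows "supersolvable V \<longleftrightarrow>
    (\<exists>(k::nat) C. C 0 = {\<zero>} \<and> C k = carrier V \<and> (\<forall>j\<le>k. leibniz_ideal (C j) V) \<and>
       (\<forall>j<k. \<exists>u\<in>C (Suc j). u \<notin> C j \<and> C (Suc j) = {v \<oplus> c \<odot> u |v c. v \<in> C j}))"
proof -
  interpret vectorspace "class_ring :: 'k ring" V by fact
  have "(C j \<subset> C (Suc j) \<and>
      vectorspace.fin_dim class_ring (leibniz_quot (V\<lparr>carrier := C (Suc j)\<rparr>) (C j)) \<and>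
      vectorspace.dim class_ring (leibniz_quot (V\<lparr>carrier := C (Suc j)\<rparr>) (C j)) = 1) \<longleftrightarrow>
    (\<exists>u\<in>C (Suc j). u \<notin> C j \<and> C (Suc j) = {v \<oplus> c \<odot> u |v c. v \<in> C j})" (is "?l \<longleftrightarrow> ?r")
    if C: "\<forall>j\<le>k. leibniz_ideal (C j) V" and j: "j < k" for k j :: nat and C
  proof -
    have sub: "VectorSpace.subspace class_ring (C j) V" "VectorSpace.subspace class_ring (C (Suc j)) V"
      using C j by (auto simp: leibniz_ideal_def)
    have CV: "C j \<subseteq> carrier V" "C (Suc j) \<subseteq> carrier V"
      using sub by (simp_all add: subspace_iff[OF V])
    \<comment> \<open>The strict inclusion can be left out on the right because it follows there:
      \<open>v = v + 0 u\<close>, and \<open>u \<notin> C j\<close>.\<close>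
    have less: "C j \<subset> C (Suc j)" if r: ?r
    proof -
      obtain u where u: "u \<in> C (Suc j)" "u \<notin> C j" "C (Suc j) = {v \<oplus> c \<odot> u |v c. v \<in> C j}"
        using r by blast
      have "v \<in> C (Suc j)" if v: "v \<in> C j" for v
      proof -
        have "v \<in> carrier V" "u \<in> carrier V"
          using v u(1) CV by blast+
        then have "v = v \<oplus> 0 \<odot> u"
          using smult_l_null[of u] by simp
        then show ?thesis
          using v u(3) by blast
      qed
      then show ?thesis
        using u by blast
    qed
    show ?thesis
      using less factor_dim_one_iff[OF V sub] by blast
  qed
  then show ?thesis
    unfolding supersolvable_def by (simp cong: conj_cong)
qed

section \<open>Eigenvectors of left multiplications\<close>

context leibniz_algebra
begin

section \<open>Linear arithmetic in a Leibniz algebra\<close>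

abbreviation sub :: "'a set \<Rightarrow> bool" where
  "sub S \<equiv> VectorSpace.subspace class_ring S L"

lemmas sub_iff = subspace_iff[OF vectorspace_axioms]

lemma sub_carrier: "sub S \<Longrightarrow> x \<in> S \<Longrightarrow> x \<in> carrier L"
  and sub_zero: "sub S \<Longrightarrow> \<zero> \<in> S"
  and sub_add: "sub S \<Longrightarrow> x \<in> S \<Longrightarrow> y \<in> S \<Longrightarrow> x \<oplus> y \<in> S"
  and sub_smult: "sub S \<Longrightarrow> x \<in> S \<Longrightarrow> c \<odot> x \<in> S"
  by (auto simp: sub_iff)

lemma smult_carrier [simp, intro]: "x \<in> carrier L \<Longrightarrow> c \<odot> x \<in> carrier L"
  by (rule smult_closed) auto

lemma smult_add: "x \<in> carrier L \<Longrightarrow> y \<in> carrier L \<Longrightarrow> c \<odot> (x \<oplus> y) = c \<odot> x \<oplus> c \<odot> y"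
  by (rule smult_r_distr) auto

lemma add_smult: "x \<in> carrier L \<Longrightarrow> (c + d) \<odot> x = c \<odot> x \<oplus> d \<odot> x"
  using smult_l_distr[of c d x] by simp

lemma smult_smult [simp]: "x \<in> carrier L \<Longrightarrow> c \<odot> (d \<odot> x) = (c * d) \<odot> x"
  using smult_assoc1[of c d x] by simp

lemma one_smult [simp]: "x \<in> carrier L \<Longrightarrow> 1 \<odot> x = x"
  using smult_one[of x] by simp

lemma zero_smult [simp]: "x \<in> carrier L \<Longrightarrow> 0 \<odot> x = \<zero>"
  using smult_l_null[of x] by simp

lemma smult_zero [simp]: "c \<odot> \<zero> = \<zero>"
  by (rule smult_r_null) auto

lemma neg_one_smult: "x \<in> carrier L \<Longrightarrow> (-1) \<odot> x = \<ominus> x"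
proof -
  assume x: "x \<in> carrier L"
  have "(-1) \<odot> x \<oplus> x = (-1 + 1) \<odot> x"
    using x by (subst add_smult) auto
  then have "(-1) \<odot> x \<oplus> x = \<zero>"
    using x by simp
  then show ?thesis
    using x by (intro M.minus_equality[symmetric]) auto
qed

lemma sub_neg: "sub S \<Longrightarrow> x \<in> S \<Longrightarrow> \<ominus> x \<in> S"
  using sub_smult[of S x "-1"] sub_carrier[of S x] by (simp add: neg_one_smult)

lemma sub_minus: "sub S \<Longrightarrow> x \<in> S \<Longrightarrow> y \<in> S \<Longrightarrow> x \<ominus> y \<in> S"
  by (simp add: M.minus_eq sub_add sub_neg)

lemma sub_add_cancel:
  "sub S \<Longrightarrow> x \<in> S \<Longrightarrow> y \<in> carrier L \<Longrightarrow> x \<oplus> y \<in> S \<longleftrightarrow> y \<in> S"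
proof
  assume *: "sub S" "x \<in> S" "y \<in> carrier L" "x \<oplus> y \<in> S"
  then have "(x \<oplus> y) \<ominus> x \<in> S"
    by (intro sub_minus)
  moreover have "(x \<oplus> y) \<ominus> x = y"
    using * sub_carrier[of S x] by (simp add: M.minus_eq M.a_comm[of x y] M.a_assoc M.r_neg)
  ultimately show "y \<in> S"
    by simp
qed (auto intro: sub_add)

lemma sub_smult_cancel:
  "sub S \<Longrightarrow> c \<noteq> 0 \<Longrightarrow> x \<in> carrier L \<Longrightarrow> c \<odot> x \<in> S \<Longrightarrow> x \<in> S"
  using sub_smult[of S "c \<odot> x" "inverse c"] by simp

lemma mult_zero_left [simp]: "x \<in> carrier L \<Longrightarrow> \<zero> \<otimes> x = \<zero>"
  using mult_smult_left[of \<zero> x 0] mult_closed[of \<zero> x] by simp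

lemma mult_zero_right [simp]: "x \<in> carrier L \<Longrightarrow> x \<otimes> \<zero> = \<zero>"
  using mult_smult_right[of x \<zero> 0] mult_closed[of x \<zero>] by simp

lemma mult_neg_right: "x \<in> carrier L \<Longrightarrow> y \<in> carrier L \<Longrightarrow> x \<otimes> (\<ominus> y) = \<ominus> (x \<otimes> y)"
  using mult_smult_right[of x y "-1"] mult_closed[of x y] by (simp add: neg_one_smult)

lemmas mult_closed [simp]

text \<open>The left Leibniz identity read as: left multiplication by a product is the commutator of
  the left multiplications.\<close>

lemma left_leibniz':
  "\<lbrakk>x \<in> carrier L; y \<in> carrier L; z \<in> carrier L\<rbrakk> \<Longrightarrow>
    (x \<otimes> y) \<otimes> z = x \<otimes> (y \<otimes> z) \<ominus> y \<otimes> (x \<otimes> z)"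
  using left_leibniz[of x y z]
  by (simp add: M.minus_eq M.a_assoc M.r_neg)

text \<open>For a subspace \<open>J\<close> this is \<open>J + \<langle>u\<rangle>\<close>, in the
  shape that \<open>supersolvable_iff\<close> gives to consecutive members of a flag.\<close>

definition adjoin :: "'a set \<Rightarrow> 'a \<Rightarrow> 'a set" where
  "adjoin J u = {j \<oplus> c \<odot> u |j c. j \<in> J}"

lemma adjoin_sub:
  assumes J: "sub J" and u: "u \<in> carrier L"
  shows "sub (adjoin J u)"
  unfolding sub_iff
proof (intro conjI ballI allI subsetI)
  show "\<zero> \<in> adjoin J u"
    using sub_zero[OF J] u by (auto simp: adjoin_def intro!: exI[of _ \<zero>] exI[of _ 0])
next
  fix x assume "x \<in> adjoin J u"
  then show "x \<in> carrier L"
    using sub_carrier[OF J] u by (auto simp: adjoin_def)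
next
  fix x y assume "x \<in> adjoin J u" "y \<in> adjoin J u"
  then obtain i j c d where *: "i \<in> J" "j \<in> J" "x = i \<oplus> c \<odot> u" "y = j \<oplus> d \<odot> u"
    by (auto simp: adjoin_def)
  then have "x \<oplus> y = (i \<oplus> j) \<oplus> (c + d) \<odot> u"
    using sub_carrier[OF J] u by (simp add: add_smult M.a_ac)
  then show "x \<oplus> y \<in> adjoin J u"
    using * sub_add[OF J] unfolding adjoin_def by blast
next
  fix c x assume "x \<in> adjoin J u"
  then obtain i d where *: "i \<in> J" "x = i \<oplus> d \<odot> u"
    by (auto simp: adjoin_def)
  then have "c \<odot> x = c \<odot> i \<oplus> (c * d) \<odot> u"
    using sub_carrier[OF J] u by (simp add: smult_add)
  then show "c \<odot> x \<in> adjoin J u"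
    using * sub_smult[OF J] unfolding adjoin_def by blast
qed

lemma adjoin_superset: "sub J \<Longrightarrow> u \<in> carrier L \<Longrightarrow> J \<subseteq> adjoin J u"
proof
  fix x assume "sub J" "u \<in> carrier L" "x \<in> J"
  then have "x = x \<oplus> 0 \<odot> u"
    by (simp add: sub_carrier)
  then show "x \<in> adjoin J u"
    using \<open>x \<in> J\<close> unfolding adjoin_def by blast
qed

lemma adjoin_mem: "sub J \<Longrightarrow> u \<in> carrier L \<Longrightarrow> u \<in> adjoin J u"
  by (auto simp: adjoin_def sub_zero intro!: exI[of _ \<zero>] exI[of _ "1 :: 'k"])

lemma adjoin_least: "sub S \<Longrightarrow> J \<subseteq> S \<Longrightarrow> u \<in> S \<Longrightarrow> adjoin J u \<subseteq> S"
  by (auto simp: adjoin_def intro!: sub_add sub_smult)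

text \<open>Horner's scheme for \<open>p\<close> evaluated at the left multiplication by \<open>x\<close>, applied to \<open>v\<close>.\<close>
definition poly_act :: "'a \<Rightarrow> 'k poly \<Rightarrow> 'a \<Rightarrow> 'a" where
  "poly_act x p v = fold_coeffs (\<lambda>c w. c \<odot> v \<oplus> x \<otimes> w) p \<zero>"

lemma poly_act_0 [simp]: "poly_act x 0 v = \<zero>"
  by (simp add: poly_act_def)

text \<open>The case \<open>p = 0\<close>, \<open>c = 0\<close> stands apart because
  \<open>pCons 0 0\<close> is \<open>0\<close> and has no coefficients to fold over; both sides are
  then zero.\<close>

lemma poly_act_pCons [simp]:
  assumes "x \<in> carrier L" "v \<in> carrier L"
  shows "poly_act x (pCons c p) v = c \<odot> v \<oplus> x \<otimes> poly_act x p v"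
  using assms by (cases "p = 0"; cases "c = 0") (auto simp: poly_act_def)

lemma poly_act_closed:
  assumes "x \<in> carrier L" "v \<in> U" "sub U" "\<And>u. u \<in> U \<Longrightarrow> x \<otimes> u \<in> U"
  shows "poly_act x p v \<in> U"
  using assms by (induction p) (auto simp: sub_zero sub_carrier intro!: sub_add sub_smult)

lemma poly_act_carrier [simp]:
  "x \<in> carrier L \<Longrightarrow> v \<in> carrier L \<Longrightarrow> poly_act x p v \<in> carrier L"
  by (induction p) auto

lemma poly_act_add:
  assumes "x \<in> carrier L" "v \<in> carrier L"
  shows "poly_act x (p + q) v = poly_act x p v \<oplus> poly_act x q v"
  using assms by (induction p q rule: poly_induct2) (auto simp: add_smult mult_add_right M.a_ac)

lemma poly_act_smult:
  assumes "x \<in> carrier L" "v \<in> carrier L"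
  shows "poly_act x (Polynomial.smult c p) v = c \<odot> poly_act x p v"
  using assms by (induction p) (auto simp: smult_add mult_smult_right)

lemma poly_act_linear_factor:
  assumes "x \<in> carrier L" "v \<in> carrier L"
  shows "poly_act x ([:-c, 1:] * p) v = x \<otimes> poly_act x p v \<ominus> c \<odot> poly_act x p v"
proof -
  have "(- c) \<odot> w = \<ominus> (c \<odot> w)" if "w \<in> carrier L" for w
    using neg_one_smult[of "c \<odot> w"] that by simp
  moreover have "[:-c, 1:] * p = pCons 0 p + Polynomial.smult (-c) p"
    by simp
  ultimately show ?thesis
    using assms by (simp only: poly_act_add poly_act_smult) (simp add: M.minus_eq)
qed

text \<open>The values at \<open>u\<close> of the polynomials of degree at most \<open>n\<close>
  form an increasing chain of subspaces \<open>S n\<close>, so two consecutive ones coincide. There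
  the power of degree \<open>n + 1\<close> acts on \<open>u\<close> like a polynomial of lower
  degree.\<close>

lemma poly_act_annihilator_exists:
  assumes fin_dim and x: "x \<in> carrier L" and u: "u \<in> carrier L"
  obtains p where "p \<noteq> 0" "poly_act x p u = \<zero>"
proof -
  define S where "S n = {poly_act x p u |p. degree p \<le> n}" for n
  have S: "sub (S n)" for n
    unfolding sub_iff
  proof (intro conjI ballI allI)
    show "S n \<subseteq> carrier L" "\<zero> \<in> S n"
      using x u by (auto simp: S_def intro!: exI[of _ "0 :: 'k poly"])
    fix v w c assume "v \<in> S n" "w \<in> S n"
    then obtain p q where "degree p \<le> n" "v = poly_act x p u" "degree q \<le> n" "w = poly_act x q u"
      by (auto simp: S_def)
    then show "v \<oplus> w \<in> S n"
      using degree_add_le[of p n q] unfolding S_def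
      by (auto intro!: exI[of _ "p + q"] simp: poly_act_add x u)
  next
    fix c v assume "v \<in> S n"
    then obtain p where "degree p \<le> n" "v = poly_act x p u"
      by (auto simp: S_def)
    then show "c \<odot> v \<in> S n"
      using degree_smult_le[of c p] unfolding S_def
      by (auto intro!: exI[of _ "Polynomial.smult c p"] simp: poly_act_smult x u)
  qed
  obtain T where T: "T \<in> range S" "\<And>T'. T' \<in> range S \<Longrightarrow> T \<subseteq> T' \<Longrightarrow> T' = T"
    by (rule maximal_subspace_exists[OF \<open>fin_dim\<close>, of "\<lambda>T. T \<in> range S" "S 0"]) (auto simp: S)
  then obtain n where n: "T = S n"
    by auto
  have "S n \<subseteq> S (Suc n)"
    by (force simp: S_def)
  then have "S (Suc n) = S n"
    using T n by auto
  moreover have "poly_act x (monom 1 (Suc n)) u \<in> S (Suc n)"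
    unfolding S_def using degree_monom_le by blast
  ultimately obtain p where p: "degree p \<le> n" "poly_act x (monom 1 (Suc n)) u = poly_act x p u"
    by (auto simp: S_def)
  define q where "q = monom 1 (Suc n) + Polynomial.smult (-1) p"
  \<comment> \<open>This coefficient ensures \<open>q \<noteq> 0\<close>.\<close>
  have "coeff q (Suc n) = 1"
    using p by (simp add: q_def coeff_eq_0)
  moreover have "poly_act x q u = \<zero>"
    unfolding q_def using p x u
    by (simp only: poly_act_add poly_act_smult) (simp add: neg_one_smult M.r_neg)
  ultimately show thesis
    by (intro that[of q]) auto
qed

text \<open>
  The locale fixes the sort of \<open>'k\<close> to be \<open>field\<close>, so algebraic closedness has to be a hypothesis here.
\<close>
lemma eigenvector_exists:
  assumes alg_closed: "\<And>p :: 'k poly. degree p > 0 \<Longrightarrow> \<exists>z. poly p z = 0"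
    and fin_dim and x: "x \<in> carrier L" and U: "sub U" and J: "sub J" and "J \<subset> U"
    and xU: "\<And>u. u \<in> U \<Longrightarrow> x \<otimes> u \<in> U"
  obtains c w where "w \<in> U" "w \<notin> J" "x \<otimes> w \<ominus> c \<odot> w \<in> J"
proof -
  obtain u where u: "u \<in> U" "u \<notin> J"
    using \<open>J \<subset> U\<close> by auto
  then have uL: "u \<in> carrier L"
    using sub_carrier U by auto
  obtain p0 where "p0 \<noteq> 0" "poly_act x p0 u = \<zero>"
    using poly_act_annihilator_exists[OF \<open>fin_dim\<close> x uL] .
  then have "p0 \<noteq> 0 \<and> poly_act x p0 u \<in> J"
    using sub_zero[OF J] by simp
  \<comment> \<open>Among the nonzero polynomials that send \<open>u\<close> into \<open>J\<close>,
    one of least degree is chosen. After a root is split off, the cofactor \<open>q\<close> has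
    smaller degree, so it sends \<open>u\<close> to a vector outside \<open>J\<close>, which is an
    eigenvector modulo \<open>J\<close>.\<close>
  then obtain p where p: "p \<noteq> 0" "poly_act x p u \<in> J"
    and min: "\<And>q. q \<noteq> 0 \<Longrightarrow> poly_act x q u \<in> J \<Longrightarrow> degree p \<le> degree q"
    using ex_has_least_nat[of "\<lambda>p. p \<noteq> 0 \<and> poly_act x p u \<in> J" p0 degree] by blast
  \<comment> \<open>A nonzero constant polynomial would put a nonzero multiple of \<open>u\<close>,
    hence \<open>u\<close> itself, into \<open>J\<close>.\<close>
  have "degree p > 0"
  proof (rule ccontr)
    assume "\<not> degree p > 0"
    then obtain a where "p = [:a:]"
      using degree_eq_zeroE by blast
    then show False
      using p u uL x sub_smult_cancel[OF J, of a u] by auto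
  qed
  then obtain c where "poly p c = 0"
    using alg_closed by blast
  then obtain q where q: "p = [:-c, 1:] * q"
    by (auto simp: poly_eq_0_iff_dvd)
  then have "q \<noteq> 0" "degree p = Suc (degree q)"
    using p by (auto simp: degree_mult_eq simp del: mult_pCons_left)
  then have "poly_act x q u \<notin> J"
    using min[of q] by auto
  moreover have "poly_act x q u \<in> U"
    using poly_act_closed[OF x u(1) U xU] .
  moreover have "x \<otimes> poly_act x q u \<ominus> c \<odot> poly_act x q u \<in> J"
    using p(2) unfolding q poly_act_linear_factor[OF x uL] .
  ultimately show thesis
    using that by blast
qed

text \<open>By \<open>comm\<close> the left multiplications commute modulo \<open>J\<close> on
  \<open>W\<close>, so an eigenspace of one is stable under all. In a minimal stable subspace
  \<open>U\<close> properly containing \<open>J\<close>, each eigenspace that meets \<open>U\<close>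
  outside \<open>J\<close> is all of \<open>U\<close>; thus every \<open>x\<close> acts on
  \<open>U/J\<close> as a scalar, and any \<open>u\<close> in \<open>U\<close> outside
  \<open>J\<close> will do.\<close>

lemma common_eigenvector_exists:
  assumes alg_closed: "\<And>p :: 'k poly. degree p > 0 \<Longrightarrow> \<exists>z. poly p z = 0"
    and fin_dim and J: "sub J" and W: "sub W" and "J \<subset> W"
    and xJ: "\<And>x w. x \<in> carrier L \<Longrightarrow> w \<in> J \<Longrightarrow> x \<otimes> w \<in> J"
    and xW: "\<And>x w. x \<in> carrier L \<Longrightarrow> w \<in> W \<Longrightarrow> x \<otimes> w \<in> W"
    and comm: "\<And>x y w. x \<in> carrier L \<Longrightarrow> y \<in> carrier L \<Longrightarrow> w \<in> W \<Longrightarrow> (x \<otimes> y) \<otimes> w \<in> J"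
  obtains u where "u \<in> W" "u \<notin> J" "\<And>x. x \<in> carrier L \<Longrightarrow> \<exists>c. x \<otimes> u \<ominus> c \<odot> u \<in> J"
proof -
  define Q where "Q U \<longleftrightarrow> sub U \<and> J \<subset> U \<and> U \<subseteq> W \<and> (\<forall>x\<in>carrier L. \<forall>u\<in>U. x \<otimes> u \<in> U)" for U
  obtain U where "Q U" and min: "\<And>T. Q T \<Longrightarrow> T \<subseteq> U \<Longrightarrow> T = U"
    by (rule minimal_subspace_exists[OF \<open>fin_dim\<close>, of Q W]) (use W \<open>J \<subset> W\<close> xW in \<open>auto simp: Q_def\<close>)
  then have U: "sub U" "J \<subset> U" "U \<subseteq> W" and xU: "\<And>x u. x \<in> carrier L \<Longrightarrow> u \<in> U \<Longrightarrow> x \<otimes> u \<in> U"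
    by (auto simp: Q_def)
  obtain u where u: "u \<in> U" "u \<notin> J"
    using U by auto
  have "\<exists>c. x \<otimes> u \<ominus> c \<odot> u \<in> J" if x: "x \<in> carrier L" for x
  proof -
    obtain c w where w: "w \<in> U" "w \<notin> J" "x \<otimes> w \<ominus> c \<odot> w \<in> J"
      using eigenvector_exists[OF alg_closed \<open>fin_dim\<close> x U(1) J U(2) xU[OF x]] by blast
    \<comment> \<open>The eigenspace of \<open>x\<close> modulo \<open>J\<close> in
      \<open>U\<close>; it properly contains \<open>J\<close> because of \<open>w\<close>.\<close>
    define E where "E = {v \<in> U. x \<otimes> v \<ominus> c \<odot> v \<in> J}"
    have EL: "v \<in> carrier L" if "v \<in> U" for v
      using that U(1) by (rule sub_carrier[rotated])
    have "sub E"
      unfolding sub_iff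
    proof (intro conjI ballI allI)
      show "E \<subseteq> carrier L" "\<zero> \<in> E"
        using EL sub_neg[OF J sub_zero[OF J]] sub_zero[OF U(1)] sub_neg[OF U(1) sub_zero[OF U(1)]] x
        by (auto simp: E_def M.minus_eq)
    next
      fix v w assume *: "v \<in> E" "w \<in> E"
      then have "v \<in> carrier L" "w \<in> carrier L"
        using EL by (auto simp: E_def)
      then have "x \<otimes> (v \<oplus> w) \<ominus> c \<odot> (v \<oplus> w) = (x \<otimes> v \<ominus> c \<odot> v) \<oplus> (x \<otimes> w \<ominus> c \<odot> w)"
        using x by (simp add: M.minus_eq mult_add_right smult_add M.minus_add M.a_ac)
      then show "v \<oplus> w \<in> E"
        using * sub_add[OF J] sub_add[OF U(1)] by (auto simp: E_def)
    next
      fix a v assume *: "v \<in> E"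
      then have v: "v \<in> carrier L"
        using EL by (auto simp: E_def)
      have "\<ominus> (c \<odot> (a \<odot> v)) = a \<odot> (\<ominus> (c \<odot> v))"
        using v neg_one_smult[of "c \<odot> (a \<odot> v)"] neg_one_smult[of "c \<odot> v"]
          smult_smult[of "c \<odot> v" a "-1"] by (simp add: mult.commute)
      then have "x \<otimes> (a \<odot> v) \<ominus> c \<odot> (a \<odot> v) = a \<odot> (x \<otimes> v \<ominus> c \<odot> v)"
        using x v by (simp add: M.minus_eq smult_add mult_smult_right)
      then show "a \<odot> v \<in> E"
        using * sub_smult[OF J] sub_smult[OF U(1)] by (auto simp: E_def)
    qed
    moreover have "y \<otimes> v \<in> E" if y: "y \<in> carrier L" and v: "v \<in> E" for y v
    proof -
      have vL: "v \<in> carrier L" and v': "v \<in> U" "v \<in> W" "x \<otimes> v \<ominus> c \<odot> v \<in> J"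
        using v EL U(3) by (auto simp: E_def)
      \<comment> \<open>Both summands on the right lie in \<open>J\<close>, the first by
        \<open>comm\<close>, the second because \<open>J\<close> is stable.\<close>
      have "x \<otimes> (y \<otimes> v) \<ominus> c \<odot> (y \<otimes> v) = (x \<otimes> y) \<otimes> v \<oplus> y \<otimes> (x \<otimes> v \<ominus> c \<odot> v)"
        using x y vL left_leibniz[OF x y vL]
        by (simp add: M.minus_eq mult_add_right mult_neg_right mult_smult_right M.a_assoc)
      then show ?thesis
        using comm[OF x y v'(2)] xJ[OF y v'(3)] sub_add[OF J] xU[OF y v'(1)] by (auto simp: E_def)
    qed
    moreover have "J \<subset> E"
    proof -
      have "J \<subseteq> E"
        using xJ[OF x] sub_minus[OF J] sub_smult[OF J] U(2) by (auto simp: E_def)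
      then show ?thesis
        using w by (auto simp: E_def)
    qed
    ultimately have "Q E"
      using U by (auto simp: Q_def E_def)
    then have "E = U"
      by (rule min) (auto simp: E_def)
    then show ?thesis
      using u by (auto simp: E_def)
  qed
  then show thesis
    using that[of u] u U by auto
qed

section \<open>Nilpotent left multiplications\<close>

text \<open>Left multiplication by \<open>x y\<close> is a commutator, so it changes sign when
  \<open>x\<close> and \<open>y\<close> are exchanged. This is the link between right and left
  multiplications.\<close>

lemma square_sum_mult:
  assumes "x \<in> carrier L" "y \<in> carrier L" "z \<in> carrier L"
  shows "(x \<otimes> y \<oplus> y \<otimes> x) \<otimes> z = \<zero>"
proof -
  have "(x \<otimes> y \<oplus> y \<otimes> x) \<otimes> z = (x \<otimes> (y \<otimes> z) \<ominus> y \<otimes> (x \<otimes> z)) \<oplus> (y \<otimes> (x \<otimes> z) \<ominus> x \<otimes> (y \<otimes> z))"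
    using assms by (simp add: mult_add_left left_leibniz')
  also have "\<dots> = \<zero>"
    using assms by (simp add: M.minus_eq M.a_ac M.r_neg M.r_neg1 M.r_neg2)
  finally show ?thesis .
qed

text \<open>Setting \<open>y = x\<close> in \<open>square_sum_mult\<close> gives only twice this
  equation, which is empty in characteristic 2; here the commutator of a map with itself
  vanishes.\<close>

lemma square_mult:
  assumes "x \<in> carrier L" "z \<in> carrier L"
  shows "(x \<otimes> x) \<otimes> z = \<zero>"
  using assms by (simp add: left_leibniz' M.minus_eq M.r_neg)

section \<open>Powers of a left multiplication and its Fitting null component\<close>

abbreviation lpow :: "'a \<Rightarrow> nat \<Rightarrow> 'a \<Rightarrow> 'a" where
  "lpow b n \<equiv> mult L b ^^ n"

lemma lpow_invariant: "(\<And>v. v \<in> S \<Longrightarrow> b \<otimes> v \<in> S) \<Longrightarrow> v \<in> S \<Longrightarrow> lpow b n v \<in> S"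
  by (induction n) auto

lemma lpow_carrier [simp]: "b \<in> carrier L \<Longrightarrow> v \<in> carrier L \<Longrightarrow> lpow b n v \<in> carrier L"
  by (rule lpow_invariant) auto

lemma lpow_zero [simp]: "b \<in> carrier L \<Longrightarrow> lpow b n \<zero> = \<zero>"
  by (induction n) auto

lemma lpow_add:
  "\<lbrakk>b \<in> carrier L; v \<in> carrier L; w \<in> carrier L\<rbrakk> \<Longrightarrow> lpow b n (v \<oplus> w) = lpow b n v \<oplus> lpow b n w"
  by (induction n) (auto simp: mult_add_right)

lemma lpow_smult: "\<lbrakk>b \<in> carrier L; v \<in> carrier L\<rbrakk> \<Longrightarrow> lpow b n (c \<odot> v) = c \<odot> lpow b n v"
  by (induction n) (auto simp: mult_smult_right)

lemma lpow_sum: "lpow b (m + n) v = lpow b m (lpow b n v)"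
  by (simp add: funpow_add)

text \<open>In \<open>b (x y) = (b x) y + x (b y)\<close> each summand needs one power less for one
  of its factors, so induction on \<open>m + n\<close> works without binomial coefficients. If
  \<open>m\<close> or \<open>n\<close> is 0, then \<open>x\<close> or \<open>y\<close> is
  zero.\<close>

lemma lpow_mult_eq_zero:
  assumes b: "b \<in> carrier L" and "x \<in> carrier L" "y \<in> carrier L"
    and "lpow b m x = \<zero>" "lpow b n y = \<zero>"
  shows "lpow b (m + n) (x \<otimes> y) = \<zero>"
  using assms(2-)
proof (induction "m + n" arbitrary: m n x y)
  case 0
  then show ?case
    using b by simp
next
  case (Suc k)
  show ?case
  proof (cases "m = 0 \<or> n = 0")
    case True
    then show ?thesis
      using Suc.prems b by auto
  next
    case False
    then obtain m' n' where mn: "m = Suc m'" "n = Suc n'"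
      by (meson not0_implies_Suc)
    have "lpow b (m' + n) ((b \<otimes> x) \<otimes> y) = \<zero>"
      using Suc.prems Suc.hyps mn b by (intro Suc.hyps(1)) (auto simp: funpow_swap1)
    moreover have "lpow b (m + n') (x \<otimes> (b \<otimes> y)) = \<zero>"
      using Suc.prems Suc.hyps mn b by (intro Suc.hyps(1)) (auto simp: funpow_swap1)
    moreover have "m + n = Suc (m' + n)" "m + n' = m' + n"
      using mn by auto
    moreover have "b \<otimes> (x \<otimes> y) = (b \<otimes> x) \<otimes> y \<oplus> x \<otimes> (b \<otimes> y)"
      using Suc.prems b by (intro left_leibniz)
    ultimately show ?thesis
      using Suc.prems b by (simp add: funpow_Suc_right lpow_add del: funpow.simps)
  qed
qed

text \<open>Closure under products is where the derivation property of left multiplication enters,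
  by way of \<open>lpow_mult_eq_zero\<close>.\<close>

lemma fitting_null_subalgebra:
  assumes b: "b \<in> carrier L"
  shows "leibniz_subalgebra {x \<in> carrier L. \<exists>n. lpow b n x = \<zero>} L"
  unfolding leibniz_subalgebra_def sub_iff
proof (intro conjI ballI allI)
  fix x y assume "x \<in> {x \<in> carrier L. \<exists>n. lpow b n x = \<zero>}" "y \<in> {x \<in> carrier L. \<exists>n. lpow b n x = \<zero>}"
  then obtain m n where *: "x \<in> carrier L" "y \<in> carrier L" "lpow b m x = \<zero>" "lpow b n y = \<zero>"
    by auto
  have "lpow b (n + m) x = \<zero>" "lpow b (m + n) y = \<zero>"
    using * b by (simp_all add: lpow_sum del: funpow_add)
  then have "lpow b (m + n) (x \<oplus> y) = \<zero>"
    using * b by (simp add: lpow_add add.commute)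
  then show "x \<oplus> y \<in> {x \<in> carrier L. \<exists>n. lpow b n x = \<zero>}"
    using * by blast
  show "x \<otimes> y \<in> {x \<in> carrier L. \<exists>n. lpow b n x = \<zero>}"
    using lpow_mult_eq_zero[OF b *] * by auto
next
  fix c x assume "x \<in> {x \<in> carrier L. \<exists>n. lpow b n x = \<zero>}"
  then obtain n where "x \<in> carrier L" "lpow b n x = \<zero>"
    by auto
  then have "c \<odot> x \<in> carrier L" "lpow b n (c \<odot> x) = \<zero>"
    using b by (simp_all add: lpow_smult)
  then show "c \<odot> x \<in> {x \<in> carrier L. \<exists>n. lpow b n x = \<zero>}"
    by blast
qed (use b in auto)

section \<open>Nilpotency forced by the Frattini subalgebra\<close>

lemma maximal_subalgebra_exists:
  assumes fin_dim and "leibniz_subalgebra S L" and "S \<noteq> carrier L"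
  obtains M where "maximal_subalgebra M L" "S \<subseteq> M"
proof -
  obtain M where M: "leibniz_subalgebra M L \<and> S \<subseteq> M \<and> M \<noteq> carrier L"
    and max: "\<And>T. leibniz_subalgebra T L \<and> S \<subseteq> T \<and> T \<noteq> carrier L \<Longrightarrow> M \<subseteq> T \<Longrightarrow> T = M"
    by (rule maximal_subspace_exists[OF \<open>fin_dim\<close>,
          of "\<lambda>M. leibniz_subalgebra M L \<and> S \<subseteq> M \<and> M \<noteq> carrier L" S])
      (use assms in \<open>auto simp: leibniz_subalgebra_def\<close>)
  then have "maximal_subalgebra M L"
    unfolding maximal_subalgebra_def by (meson subset_trans)
  then show thesis
    using that M by blast
qed

text \<open>If the null component \<open>L0\<close> were proper, it would lie in a maximal
  subalgebra \<open>M\<close>, which also contains \<open>I\<close>. But Fitting's argument gives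
  \<open>L = L0 + I\<close>, so \<open>M\<close> would be everything.\<close>

lemma nilpotent_of_frattini:
  assumes fin_dim and I: "sub I" "I \<subseteq> frattini L" and b: "b \<in> carrier L"
    and k: "\<And>x. x \<in> carrier L \<Longrightarrow> lpow b k x \<in> I" and x: "x \<in> carrier L"
  shows "\<exists>n. lpow b n x = \<zero>"
proof (rule ccontr)
  define L0 where "L0 = {x \<in> carrier L. \<exists>n. lpow b n x = \<zero>}"
  assume "\<not> ?thesis"
  then have "L0 \<noteq> carrier L"
    using x by (auto simp: L0_def)
  then obtain M where M: "maximal_subalgebra M L" "L0 \<subseteq> M"
    using maximal_subalgebra_exists[OF \<open>fin_dim\<close>] fitting_null_subalgebra[OF b] unfolding L0_def by blast
  then have "I \<subseteq> M" and subM: "sub M" and "M \<noteq> carrier L"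
    using I by (auto simp: frattini_def maximal_subalgebra_def leibniz_subalgebra_def)
  define Q where "Q T \<longleftrightarrow> (\<exists>n. T = lpow b n ` carrier L)" for T
  have img: "sub (lpow b n ` carrier L)" for n
    unfolding sub_iff
  proof (intro conjI ballI allI)
    show "\<zero> \<in> lpow b n ` carrier L"
      using b by (intro image_eqI[of _ _ \<zero>]) auto
  next
    fix v w assume "v \<in> lpow b n ` carrier L" "w \<in> lpow b n ` carrier L"
    then show "v \<oplus> w \<in> lpow b n ` carrier L"
      using b by (auto simp: lpow_add[symmetric])
  qed (use b in \<open>auto simp: lpow_smult[symmetric]\<close>)
  have Q: "\<And>S. Q S \<Longrightarrow> sub S" "Q (lpow b 0 ` carrier L)"
    using img unfolding Q_def by blast+
  \<comment> \<open>A minimal image of a power is the Fitting one component; higher powers have the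
    same image.\<close>
  obtain T where "Q T" and min: "\<And>T'. Q T' \<Longrightarrow> T' \<subseteq> T \<Longrightarrow> T' = T"
    by (rule minimal_subspace_exists[OF \<open>fin_dim\<close>, of Q "lpow b 0 ` carrier L"]) (use Q in auto)
  then obtain n where T: "T = lpow b n ` carrier L"
    by (auto simp: Q_def)
  have "lpow b (n + k) ` carrier L = T"
  proof (rule min)
    show "Q (lpow b (n + k) ` carrier L)"
      unfolding Q_def by blast
    show "lpow b (n + k) ` carrier L \<subseteq> T"
      using b by (auto simp: T lpow_sum)
  qed
  then have eq: "lpow b (n + k) ` carrier L = lpow b n ` carrier L"
    using T by simp
  have "y \<in> M" if y: "y \<in> carrier L" for y
  proof -
    \<comment> \<open>The \<open>n\<close>-th power takes the same value at \<open>y\<close> and at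
      \<open>lpow b k z\<close>, so their difference lies in \<open>L0\<close>, while
      \<open>lpow b k z\<close> lies in \<open>I\<close>.\<close>
    obtain z where z: "z \<in> carrier L" "lpow b n y = lpow b n (lpow b k z)"
      using eq y unfolding lpow_sum by blast
    let ?w = "lpow b k z"
    have w: "?w \<in> I" "?w \<in> carrier L"
      using k z b by auto
    have "lpow b n (\<ominus> ?w) = \<ominus> lpow b n ?w"
      using lpow_smult[OF b w(2), of n "-1"] w b by (simp add: neg_one_smult)
    then have "lpow b n (y \<ominus> ?w) = \<zero>"
      using w y b z by (simp add: M.minus_eq lpow_add M.r_neg)
    then have "y \<ominus> ?w \<in> M"
      using y w M(2) by (auto simp: L0_def)
    then have "?w \<oplus> (y \<ominus> ?w) \<in> M"
      using w \<open>I \<subseteq> M\<close> by (intro sub_add[OF subM]) auto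
    moreover have "?w \<oplus> (y \<ominus> ?w) = y"
      using w y by (simp add: M.minus_eq M.a_comm[of y] M.r_neg2 M.r_neg1 M.a_assoc[symmetric] M.r_neg)
    ultimately show ?thesis
      by simp
  qed
  then show False
    using \<open>M \<noteq> carrier L\<close> subM by (auto simp: sub_iff)
qed

text \<open>A maximal subalgebra \<open>H\<close> of \<open>N\<close> with the required property
  \<open>P\<close> is shown to be \<open>N\<close>: acting on \<open>N\<close> modulo
  \<open>H\<close>, it yields \<open>b \<notin> H\<close> with \<open>H b \<subseteq> H\<close>, and
  the larger subalgebra \<open>H + \<langle>b\<rangle>\<close> again has the property.\<close>

lemma engel:
  assumes fin_dim and N: "sub N" and NN: "\<And>x y. x \<in> N \<Longrightarrow> y \<in> N \<Longrightarrow> x \<otimes> y \<in> N"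
    and nil: "\<And>b v. b \<in> N \<Longrightarrow> v \<in> carrier L \<Longrightarrow> \<exists>n. lpow b n v = \<zero>"
    and "sub J" "sub V" "J \<subset> V"
    and "\<And>b v. b \<in> N \<Longrightarrow> v \<in> J \<Longrightarrow> b \<otimes> v \<in> J"
    and "\<And>b v. b \<in> N \<Longrightarrow> v \<in> V \<Longrightarrow> b \<otimes> v \<in> V"
  obtains v where "v \<in> V" "v \<notin> J" "\<And>b. b \<in> N \<Longrightarrow> b \<otimes> v \<in> J"
proof -
  define stable where "stable H W \<longleftrightarrow> sub W \<and> (\<forall>h\<in>H. \<forall>v\<in>W. h \<otimes> v \<in> W)" for H W
  \<comment> \<open>All stable pairs are allowed because the property is used for the pair
    \<open>H \<subset> N\<close> inside the induction and for \<open>J \<subset> V\<close> at the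
    end.\<close>
  define P where "P H \<longleftrightarrow>
    (\<forall>W V. stable H W \<longrightarrow> stable H V \<longrightarrow> W \<subset> V \<longrightarrow> (\<exists>v\<in>V - W. \<forall>h\<in>H. h \<otimes> v \<in> W))" for H
  define Z where "Z = {x \<in> N. \<forall>y\<in>carrier L. x \<otimes> y = \<zero>}"
  \<comment> \<open>\<open>Z\<close> contains all squares \<open>b b\<close> and all \<open>h b + b h\<close>; requiring \<open>Z \<subseteq> H\<close> makes \<open>H + \<langle>b\<rangle>\<close> a subalgebra
    as soon as \<open>H b \<subseteq> H\<close>.\<close>
  define R where "R H \<longleftrightarrow> sub H \<and> Z \<subseteq> H \<and> H \<subseteq> N \<and> (\<forall>x\<in>H. \<forall>y\<in>H. x \<otimes> y \<in> H) \<and> P H" for H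
  have NL: "x \<in> carrier L" if "x \<in> N" for x
    using sub_carrier[OF N that] .
  have "sub Z"
    using NL sub_zero[OF N] sub_add[OF N] sub_smult[OF N]
    by (auto simp: sub_iff Z_def mult_add_left mult_smult_left)
  \<comment> \<open>\<open>Z\<close> annihilates everything, so any vector of \<open>V\<close>
    outside \<open>W\<close> will do.\<close>
  have "P Z"
    unfolding P_def stable_def using sub_carrier sub_zero by (fastforce simp: Z_def)
  then have RZ: "R Z"
    using \<open>sub Z\<close> NL sub_zero[OF \<open>sub Z\<close>] by (auto simp: R_def Z_def)
  have R_sub: "\<And>H. R H \<Longrightarrow> sub H"
    by (simp add: R_def)
  obtain H where "R H" and max: "\<And>T. R T \<Longrightarrow> H \<subseteq> T \<Longrightarrow> T = H"
    by (rule maximal_subspace_exists[OF \<open>fin_dim\<close>, of R Z]) (rule R_sub RZ | blast)+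
  have H: "sub H" "Z \<subseteq> H" "H \<subseteq> N" "\<And>x y. x \<in> H \<Longrightarrow> y \<in> H \<Longrightarrow> x \<otimes> y \<in> H" "P H"
    using \<open>R H\<close> unfolding R_def by blast+
  have "H = N"
  proof (rule ccontr)
    assume "H \<noteq> N"
    then have "H \<subset> N"
      using H(3) by auto
    moreover have "stable H H" "stable H N"
      using H N NN by (auto simp: stable_def)
    ultimately have "\<exists>v\<in>N - H. \<forall>h\<in>H. h \<otimes> v \<in> H"
      using H(5) unfolding P_def by simp
    then obtain b where b: "b \<in> N" "b \<notin> H" and Hb: "\<And>h. h \<in> H \<Longrightarrow> h \<otimes> b \<in> H"
      by auto
    have bL: "b \<in> carrier L" and HL: "\<And>h. h \<in> H \<Longrightarrow> h \<in> carrier L"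
      using b H NL by auto
    have bb: "b \<otimes> b \<in> H"
      using H(2) square_mult[OF bL] NN[OF b(1) b(1)] by (auto simp: Z_def)
    have bH: "b \<otimes> h \<in> H" if "h \<in> H" for h
    proof -
      have "h \<otimes> b \<oplus> b \<otimes> h \<in> Z"
        using that H(3) b NN sub_add[OF N] square_sum_mult bL HL by (auto simp: Z_def)
      then show ?thesis
        using H(2) sub_add_cancel[OF H(1) Hb[OF that], of "b \<otimes> h"] that bL HL by auto
    qed
    define H' where "H' = adjoin H b"
    have H': "sub H'" "H \<subseteq> H'" "b \<in> H'" "H' \<subseteq> N"
      using adjoin_sub adjoin_superset adjoin_mem adjoin_least[OF N H(3) b(1)] H bL
      by (auto simp: H'_def)
    have "x \<otimes> y \<in> H'" if xy: "x \<in> H'" "y \<in> H'" for x y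
    proof -
      obtain g c h d where *: "g \<in> H" "h \<in> H" "x = g \<oplus> c \<odot> b" "y = h \<oplus> d \<odot> b"
        using xy by (auto simp: H'_def adjoin_def)
      then have "x \<otimes> y = (g \<otimes> h \<oplus> d \<odot> (g \<otimes> b)) \<oplus> (c \<odot> (b \<otimes> h) \<oplus> (c * d) \<odot> (b \<otimes> b))"
        using bL HL by (simp add: mult_add_left mult_add_right mult_smult_left mult_smult_right
            smult_add M.a_ac mult.commute)
      then have "x \<otimes> y \<in> H"
        using * bb bH Hb H(4) by (auto intro!: sub_add[OF H(1)] sub_smult[OF H(1)])
      then show ?thesis
        using H' by auto
    qed
    moreover have "P H'"
      unfolding P_def
    proof (intro allI impI)
      fix W V assume W': "stable H' W" and V': "stable H' V" and "W \<subset> V"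
      then have W: "sub W" "\<And>h v. h \<in> H' \<Longrightarrow> v \<in> W \<Longrightarrow> h \<otimes> v \<in> W"
        and V: "sub V" "\<And>h v. h \<in> H' \<Longrightarrow> v \<in> V \<Longrightarrow> h \<otimes> v \<in> V"
        by (auto simp: stable_def)
      \<comment> \<open>\<open>U\<close> is stable under \<open>b\<close>, since
        \<open>h (b v) = (h b) v + b (h v)\<close> and \<open>h b \<in> H\<close>. So a vector
        killed by \<open>b\<close> modulo \<open>W\<close> can be sought inside
        \<open>U\<close>.\<close>
      define U where "U = {v \<in> V. \<forall>h\<in>H. h \<otimes> v \<in> W}"
      have "stable H W" "stable H V"
        using W V H'(2) by (auto simp: stable_def)
      then have "\<exists>v\<in>V - W. \<forall>h\<in>H. h \<otimes> v \<in> W"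
        using H(5) \<open>W \<subset> V\<close> unfolding P_def by simp
      then obtain u where u: "u \<in> U" "u \<notin> W"
        by (auto simp: U_def)
      have bU: "b \<otimes> v \<in> U" if v: "v \<in> U" for v
      proof -
        have vL: "v \<in> carrier L" "v \<in> V"
          using v sub_carrier[OF V(1)] by (auto simp: U_def)
        have "h \<otimes> (b \<otimes> v) \<in> W" if h: "h \<in> H" for h
          using left_leibniz[OF HL[OF h] bL vL(1)] v h Hb[OF h] W(2)[OF H'(3)]
          by (auto simp: U_def intro: sub_add[OF W(1)])
        then show ?thesis
          using V(2)[OF H'(3) vL(2)] by (auto simp: U_def)
      qed
      have uL: "u \<in> carrier L"
        using u sub_carrier[OF V(1)] by (auto simp: U_def)
      obtain n where "lpow b n u = \<zero>"
        using nil[OF b(1) uL] by blast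
      then have ex: "\<exists>n. lpow b n u \<in> W"
        using sub_zero[OF W(1)] by (intro exI[of _ n]) simp
      \<comment> \<open>The first power of \<open>b\<close> that takes \<open>u\<close> into
        \<open>W\<close>. It is not the zeroth, as \<open>u \<notin> W\<close>, so its predecessor
        gives a vector of \<open>U\<close> outside \<open>W\<close> that \<open>b\<close> sends into
        \<open>W\<close>.\<close>
      define n where "n = (LEAST n. lpow b n u \<in> W)"
      have n: "lpow b n u \<in> W"
        unfolding n_def using ex by (rule LeastI_ex)
      then obtain m where m: "n = Suc m"
        using u by (cases n) auto
      then have "lpow b m u \<notin> W"
        using not_less_Least[of m "\<lambda>n. lpow b n u \<in> W"] n_def by auto
      moreover have v: "lpow b m u \<in> U"
        using bU u(1) by (rule lpow_invariant)
      moreover have "h \<otimes> lpow b m u \<in> W" if h: "h \<in> H'" for h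
      proof -
        obtain g c where g: "g \<in> H" "h = g \<oplus> c \<odot> b"
          using h by (auto simp: H'_def adjoin_def)
        then have "h \<otimes> lpow b m u = g \<otimes> lpow b m u \<oplus> c \<odot> (b \<otimes> lpow b m u)"
          using bL HL uL by (simp add: mult_add_left mult_smult_left)
        then show ?thesis
          using v g n m by (auto simp: U_def intro!: sub_add[OF W(1)] sub_smult[OF W(1)])
      qed
      ultimately show "\<exists>v\<in>V - W. \<forall>h\<in>H'. h \<otimes> v \<in> W"
        by (auto simp: U_def)
    qed
    ultimately have "R H'"
      using H H' by (auto simp: R_def)
    then have "H' = H"
      using H'(2) by (rule max)
    then show False
      using b H' by auto
  qed
  then have "P N" "stable N J" "stable N V"
    using H(5) assms by (auto simp: stable_def)
  then have "\<exists>v\<in>V - J. \<forall>h\<in>N. h \<otimes> v \<in> J"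
    using \<open>J \<subset> V\<close> unfolding P_def by simp
  then show thesis
    using that by auto
qed

text \<open>On the quotient of \<open>J + \<langle>u\<rangle>\<close> by \<open>J\<close> the left
  multiplications are scalars, so their commutators vanish there.\<close>

lemma commutator_adjoin:
  assumes J: "sub J" and xJ: "\<And>x v. x \<in> carrier L \<Longrightarrow> v \<in> J \<Longrightarrow> x \<otimes> v \<in> J"
    and u: "u \<in> carrier L" and xu: "\<And>x. x \<in> carrier L \<Longrightarrow> x \<otimes> u \<in> adjoin J u"
    and x: "x \<in> carrier L" and y: "y \<in> carrier L" and v: "v \<in> adjoin J u"
  shows "(x \<otimes> y) \<otimes> v \<in> J"
proof -
  obtain i c where i: "i \<in> J" "x \<otimes> u = i \<oplus> c \<odot> u"
    using xu[OF x] by (auto simp: adjoin_def)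
  obtain j d where j: "j \<in> J" "y \<otimes> u = j \<oplus> d \<odot> u"
    using xu[OF y] by (auto simp: adjoin_def)
  obtain h a where h: "h \<in> J" "v = h \<oplus> a \<odot> u"
    using v by (auto simp: adjoin_def)
  have L: "i \<in> carrier L" "j \<in> carrier L" "h \<in> carrier L"
    using i j h sub_carrier[OF J] by auto
  have "(x \<otimes> y) \<otimes> u = x \<otimes> (j \<oplus> d \<odot> u) \<ominus> y \<otimes> (i \<oplus> c \<odot> u)"
    using left_leibniz'[OF x y u] i j by simp
  also have "\<dots> = (x \<otimes> j \<oplus> d \<odot> (i \<oplus> c \<odot> u)) \<ominus> (y \<otimes> i \<oplus> c \<odot> (j \<oplus> d \<odot> u))"
    using x y u L i j by (simp add: mult_add_right mult_smult_right)
  \<comment> \<open>The multiples \<open>(d c) u\<close> and \<open>(c d) u\<close> cancel.\<close>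
  also have "\<dots> = (x \<otimes> j \<oplus> d \<odot> i) \<ominus> (y \<otimes> i \<oplus> c \<odot> j)"
    using x y u L by (simp add: smult_add M.minus_eq M.minus_add M.a_ac mult.commute M.r_neg M.r_neg1 M.r_neg2)
  also have "\<dots> \<in> J"
    using i j xJ x y by (intro sub_minus[OF J] sub_add[OF J] sub_smult[OF J]) auto
  finally have "(x \<otimes> y) \<otimes> u \<in> J" .
  then have "(x \<otimes> y) \<otimes> h \<oplus> a \<odot> ((x \<otimes> y) \<otimes> u) \<in> J"
    using h xJ x y by (intro sub_add[OF J] sub_smult[OF J]) auto
  then show ?thesis
    using x y u L h by (simp add: mult_add_right mult_smult_right)
qed

section \<open>Flags of ideals\<close>

lemma ideal_sub: "leibniz_ideal J L \<Longrightarrow> sub J"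
  and ideal_mult_left: "leibniz_ideal J L \<Longrightarrow> x \<in> carrier L \<Longrightarrow> y \<in> J \<Longrightarrow> x \<otimes> y \<in> J"
  and ideal_mult_right: "leibniz_ideal J L \<Longrightarrow> x \<in> carrier L \<Longrightarrow> y \<in> J \<Longrightarrow> y \<otimes> x \<in> J"
  by (auto simp: leibniz_ideal_def)

text \<open>The end points are arbitrary, so that a flag up to \<open>I\<close> can be glued to a
  flag from \<open>I\<close> to \<open>L\<close>.\<close>

definition ideal_flag :: "'a set \<Rightarrow> 'a set \<Rightarrow> nat \<Rightarrow> (nat \<Rightarrow> 'a set) \<Rightarrow> bool" where
  "ideal_flag S T k C \<longleftrightarrow> C 0 = S \<and> C k = T \<and> (\<forall>j\<le>k. leibniz_ideal (C j) L) \<and>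
     (\<forall>j<k. \<exists>u\<in>C (Suc j). u \<notin> C j \<and> C (Suc j) = adjoin (C j) u)"

lemma supersolvable_iff_flag: "supersolvable L \<longleftrightarrow> (\<exists>k C. ideal_flag {\<zero>} (carrier L) k C)"
  unfolding supersolvable_iff[OF vectorspace_axioms] ideal_flag_def adjoin_def ..

lemma ideal_flag_extend:
  assumes C: "ideal_flag S T k C" and u: "u \<in> carrier L" "u \<notin> T" "leibniz_ideal (adjoin T u) L"
  shows "ideal_flag S (adjoin T u) (Suc k) (C(Suc k := adjoin T u))"
proof -
  have "leibniz_ideal T L"
    using C by (auto simp: ideal_flag_def)
  then have "u \<in> adjoin T u"
    using adjoin_mem ideal_sub u by blast
  then show ?thesis
    using C u by (auto simp: ideal_flag_def less_Suc_eq le_Suc_eq)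
qed

text \<open>The members of \<open>D\<close> are appended one at a time with
  \<open>ideal_flag_extend\<close>, which avoids reindexing the two sequences.\<close>

lemma ideal_flag_trans:
  assumes C: "ideal_flag S T k C" and D: "ideal_flag T U m D"
  shows "\<exists>k C. ideal_flag S U k C"
proof -
  have "j \<le> m \<Longrightarrow> \<exists>k C. ideal_flag S (D j) k C" for j
  proof (induction j)
    case 0
    then show ?case
      using C D by (auto simp: ideal_flag_def)
  next
    case (Suc j)
    then obtain k C where *: "ideal_flag S (D j) k C"
      by auto
    have id: "leibniz_ideal (D (Suc j)) L"
      using D Suc.prems by (auto simp: ideal_flag_def)
    obtain u where u: "u \<in> D (Suc j)" "u \<notin> D j" "D (Suc j) = adjoin (D j) u"
      using D Suc.prems by (auto simp: ideal_flag_def Suc_le_eq)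
    have "u \<in> carrier L"
      using sub_carrier[OF ideal_sub[OF id] u(1)] .
    then show ?case
      using ideal_flag_extend[OF *, of u] u id by auto
  qed
  then show ?thesis
    using D by (auto simp: ideal_flag_def)
qed

text \<open>The flag consists of the preimages of the ideals in a flag of \<open>L/I\<close>; a
  representative of a generator upstairs generates the corresponding step.\<close>

lemma quotient_flag_exists:
  assumes I: "leibniz_ideal I L" and ss: "supersolvable (leibniz_quot L I)"
  obtains k D where "ideal_flag I (carrier L) k D"
proof -
  let ?Q = "leibniz_quot L I"
  interpret Q: quotient_vectorspace L I
    using ideal_sub[OF I] vectorspace_axioms
    by (simp add: quotient_vectorspace_def quotient_vectorspace_axioms_def)
  note Q_iff = subspace_iff[OF Q.quotient_is_vectorspace]
  obtain k C where C0: "C 0 = {I}" and Ck: "C k = a_rcosets I"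
    and id: "\<And>j. j \<le> k \<Longrightarrow> leibniz_ideal (C j) ?Q"
    and step: "\<And>j. j < k \<Longrightarrow> \<exists>A\<in>C (Suc j). A \<notin> C j \<and>
      C (Suc j) = {B \<oplus>\<^bsub>?Q\<^esub> c \<odot>\<^bsub>?Q\<^esub> A |B c. B \<in> C j}"
    using ss unfolding supersolvable_iff[OF Q.quotient_is_vectorspace] by auto
  define D where "D j = {x \<in> carrier L. I +> x \<in> C j}" for j
  have IL: "x \<in> carrier L" if "x \<in> I" for x
    using that Q.W_carrier by blast
  \<comment> \<open>\<open>rcoset_mult\<close> is a union over all pairs of representatives. They
    all give the same coset because \<open>(i + x) (j + y)\<close> and \<open>x y\<close> differ by
    an element of the two-sided ideal \<open>I\<close>.\<close>
  have coset_mult: "rcoset_mult L I (I +> x) (I +> y) = I +> (x \<otimes> y)"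
    if xy: "x \<in> carrier L" "y \<in> carrier L" for x y
  proof -
    have "I +> (a \<otimes> b) = I +> (x \<otimes> y)" if ab: "a \<in> I +> x" "b \<in> I +> y" for a b
    proof -
      obtain i j where ij: "i \<in> I" "a = i \<oplus> x" "j \<in> I" "b = j \<oplus> y"
        using ab by (auto simp: a_r_coset_def')
      then have "a \<otimes> b = (i \<otimes> j \<oplus> i \<otimes> y \<oplus> x \<otimes> j) \<oplus> x \<otimes> y"
        using xy IL by (simp add: mult_add_left mult_add_right M.a_ac)
      moreover have "i \<otimes> j \<oplus> i \<otimes> y \<oplus> x \<otimes> j \<in> I"
        using ij xy IL ideal_mult_left[OF I] ideal_mult_right[OF I] by (intro Q.W_add) auto
      ultimately have "a \<otimes> b \<in> I +> (x \<otimes> y)"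
        by (auto simp: a_r_coset_def')
      then show ?thesis
        by (rule Q.a_repr_independence'[OF _ mult_closed[OF xy], symmetric])
    qed
    then have "rcoset_mult L I (I +> x) (I +> y) = (\<Union>a\<in>I +> x. \<Union>b\<in>I +> y. I +> (x \<otimes> y))"
      unfolding rcoset_mult_def by (intro SUP_cong refl)
    then show ?thesis
      using Q.a_rcos_self xy by auto
  qed
  have Dideal: "leibniz_ideal (D j) L" if j: "j \<le> k" for j
    unfolding leibniz_ideal_def
  proof (intro conjI ballI)
    have C: "C j \<subseteq> a_rcosets I" "I \<in> C j"
      "\<And>A B. A \<in> C j \<Longrightarrow> B \<in> C j \<Longrightarrow> A <+> B \<in> C j"
      "\<And>c A. A \<in> C j \<Longrightarrow> c \<odot>\<^bsub>?Q\<^esub> A \<in> C j"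
      using id[OF j] by (auto simp: leibniz_ideal_def Q_iff)
    show "sub (D j)"
      unfolding sub_iff
    proof (intro conjI ballI allI)
      show "\<zero> \<in> D j"
        using C(2) Q.coset_zero by (simp add: D_def)
      show "x \<oplus> y \<in> D j" if "x \<in> D j" "y \<in> D j" for x y
        using that C(3)[of "I +> x" "I +> y"] by (simp add: D_def Q.coset_add)
      show "c \<odot> x \<in> D j" if "x \<in> D j" for c x
        using that C(4)[of "I +> x" c] by (simp add: D_def Q.coset_smult)
    qed (auto simp: D_def)
    fix x y assume x: "x \<in> carrier L" and y: "y \<in> D j"
    have "I +> x \<in> a_rcosets I"
      using x Q.a_subset by (intro M.a_rcosetsI)
    then have "rcoset_mult L I (I +> x) (I +> y) \<in> C j" "rcoset_mult L I (I +> y) (I +> x) \<in> C j"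
      using id[OF j] y by (auto simp: leibniz_ideal_def D_def)
    then show "x \<otimes> y \<in> D j" "y \<otimes> x \<in> D j"
      using x y by (simp_all add: D_def coset_mult)
  qed
  have "ideal_flag I (carrier L) k D"
    unfolding ideal_flag_def
  proof (intro conjI allI impI)
    show "D 0 = I"
      using Q.coset_eq_W_iff IL unfolding D_def C0 by blast
    show "D k = carrier L"
      using Q.a_subset by (auto simp: D_def Ck intro: M.a_rcosetsI)
    fix j assume j: "j < k"
    have Cj: "C j \<subseteq> a_rcosets I" "C (Suc j) \<subseteq> a_rcosets I"
      using id[of j] id[of "Suc j"] j by (auto simp: leibniz_ideal_def Q_iff)
    obtain A where A: "A \<in> C (Suc j)" "A \<notin> C j"
      and Csuc: "C (Suc j) = {B \<oplus>\<^bsub>?Q\<^esub> c \<odot>\<^bsub>?Q\<^esub> A |B c. B \<in> C j}"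
      using step[OF j] by blast
    obtain u where u: "u \<in> carrier L" "A = I +> u"
      using A(1) Cj(2) by (blast elim: Q.cosetE)
    have uD: "u \<in> D (Suc j)" "u \<notin> D j"
      using A u by (auto simp: D_def)
    have sub: "sub (D j)" "sub (D (Suc j))"
      using j Dideal ideal_sub by auto
    have "x \<in> D (Suc j)" if "x \<in> D j" for x
    proof -
      have x: "x \<in> carrier L" "I +> x \<in> C j"
        using that by (auto simp: D_def)
      have "I +> x = (I +> x) \<oplus>\<^bsub>?Q\<^esub> 0 \<odot>\<^bsub>?Q\<^esub> A"
        using x u by (simp add: Q.coset_smult Q.coset_add)
      then have "I +> x \<in> C (Suc j)"
        unfolding Csuc using x(2) by blast
      then show ?thesis
        using x by (simp add: D_def)
    qed
    then have "adjoin (D j) u \<subseteq> D (Suc j)"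
      using adjoin_least[OF sub(2) _ uD(1)] by blast
    moreover have "x \<in> adjoin (D j) u" if "x \<in> D (Suc j)" for x
    proof -
      have x: "x \<in> carrier L" "I +> x \<in> C (Suc j)"
        using that by (auto simp: D_def)
      then obtain B c where B: "B \<in> C j" "I +> x = B \<oplus>\<^bsub>?Q\<^esub> c \<odot>\<^bsub>?Q\<^esub> A"
        using Csuc by auto
      obtain v where v: "v \<in> carrier L" "B = I +> v"
        using B(1) Cj(1) by (blast elim: Q.cosetE)
      have "I +> x = I +> (v \<oplus> c \<odot> u)"
        using B v u by (simp add: Q.coset_smult Q.coset_add)
      then have "x \<in> I +> (v \<oplus> c \<odot> u)"
        using Q.a_rcos_self[OF x(1)] by simp
      then obtain i where i: "i \<in> I" "x = i \<oplus> (v \<oplus> c \<odot> u)"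
        by (auto simp: a_r_coset_def')
      \<comment> \<open>Absorbing \<open>i\<close> into \<open>v\<close> does not change the coset
        \<open>B\<close>, so \<open>i + v\<close> is an element of \<open>D j\<close>.\<close>
      have "i \<oplus> v \<in> I +> v"
        using i by (auto simp: a_r_coset_def')
      then have "I +> (i \<oplus> v) = B"
        using Q.a_repr_independence'[OF _ v(1)] v(2) by simp
      then have "i \<oplus> v \<in> D j"
        using B(1) i v IL by (simp add: D_def)
      moreover have "x = (i \<oplus> v) \<oplus> c \<odot> u"
        using i v u IL by (simp add: M.a_assoc)
      ultimately show ?thesis
        unfolding adjoin_def by blast
    qed
    ultimately show "\<exists>u\<in>D (Suc j). u \<notin> D j \<and> D (Suc j) = adjoin (D j) u"
      using uD by blast
  qed (use Dideal in auto)
  then show thesis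
    by (rule that)
qed

text \<open>The growth step for the flag below \<open>I\<close>. Right multiplications are dealt
  with by the choice of \<open>V\<close>. Engel's theorem then supplies a subspace \<open>W\<close>
  of \<open>V\<close>, larger than \<open>J\<close>, on which the left multiplications commute
  modulo \<open>J\<close>, and \<open>u\<close> is a common eigenvector there.\<close>

lemma ideal_extension_exists:
  assumes alg_closed: "\<And>p :: 'k poly. degree p > 0 \<Longrightarrow> \<exists>z. poly p z = 0"
    and fin_dim and I: "leibniz_ideal I L" and IF: "I \<subseteq> frattini L"
    and D: "ideal_flag I (carrier L) k D"
    and J: "leibniz_ideal J L" and "J \<subset> I"
  obtains u where "u \<in> I" "u \<notin> J" "leibniz_ideal (adjoin J u) L"
proof -
  have D0: "D 0 = I" and Dk: "D k = carrier L" and Did: "\<And>j. j \<le> k \<Longrightarrow> leibniz_ideal (D j) L"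
    and step: "\<And>j. j < k \<Longrightarrow> \<exists>u\<in>D (Suc j). u \<notin> D j \<and> D (Suc j) = adjoin (D j) u"
    using D by (auto simp: ideal_flag_def)
  have subI: "sub I" and subJ: "sub J"
    using I J ideal_sub by auto
  have IL: "\<And>x. x \<in> I \<Longrightarrow> x \<in> carrier L"
    using sub_carrier[OF subI] .
  \<comment> \<open>The elements that act as zero on every factor of \<open>D\<close>. The factors
    are one-dimensional, so by \<open>commutator_adjoin\<close> all products lie in
    \<open>N\<close>.\<close>
  define N where "N = {x \<in> carrier L. \<forall>j<k. \<forall>v\<in>D (Suc j). x \<otimes> v \<in> D j}"
  have NL: "\<And>x. x \<in> N \<Longrightarrow> x \<in> carrier L"
    by (simp add: N_def)
  have DL: "j < k \<Longrightarrow> v \<in> D (Suc j) \<Longrightarrow> v \<in> carrier L" for j v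
    using sub_carrier[OF ideal_sub[OF Did[of "Suc j"]]] by simp
  have Dsub: "j < k \<Longrightarrow> sub (D j)" for j
    using ideal_sub Did by simp
  have subN: "sub N"
    unfolding sub_iff
  proof (intro conjI ballI allI)
    have "\<zero> \<otimes> v \<in> D j" if "j < k" "v \<in> D (Suc j)" for j v
      using DL sub_zero[OF Dsub] that by simp
    then show "\<zero> \<in> N"
      by (simp add: N_def)
    show "x \<oplus> y \<in> N" if "x \<in> N" "y \<in> N" for x y
      using that DL sub_add[OF Dsub] by (auto simp: N_def mult_add_left)
    show "c \<odot> x \<in> N" if "x \<in> N" for c x
      using that DL sub_smult[OF Dsub] by (auto simp: N_def mult_smult_left)
  qed (auto simp: N_def)
  have LL: "x \<otimes> y \<in> N" if xy: "x \<in> carrier L" "y \<in> carrier L" for x y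
  proof -
    have "(x \<otimes> y) \<otimes> v \<in> D j" if j: "j < k" and v: "v \<in> D (Suc j)" for j v
    proof -
      obtain u where u: "u \<in> D (Suc j)" "D (Suc j) = adjoin (D j) u"
        using step[OF j] by blast
      have zu: "z \<otimes> u \<in> adjoin (D j) u" if "z \<in> carrier L" for z
        using ideal_mult_left[OF Did[of "Suc j"] that u(1)] u(2) j by simp
      have zw: "z \<otimes> w \<in> D j" if "z \<in> carrier L" "w \<in> D j" for z w
        using ideal_mult_left[OF Did[of j]] that j by simp
      show ?thesis
        using commutator_adjoin[OF Dsub[OF j] zw DL[OF j u(1)] zu xy] v u(2) by simp
    qed
    then show ?thesis
      using xy by (simp add: N_def)
  qed
  \<comment> \<open>Each application of \<open>b\<close> lowers the index in \<open>D\<close> by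
    one, so \<open>k\<close> of them take \<open>L\<close> into \<open>D 0 = I\<close>; then
    \<open>nilpotent_of_frattini\<close> applies.\<close>
  have nil: "\<exists>n. lpow b n v = \<zero>" if b: "b \<in> N" and v: "v \<in> carrier L" for b v
  proof -
    have "lpow b i x \<in> D (k - i)" if x: "x \<in> carrier L" and "i \<le> k" for x i
      using \<open>i \<le> k\<close>
    proof (induction i)
      case (Suc i)
      then have "k - i = Suc (k - Suc i)" "k - Suc i < k"
        by auto
      then show ?case
        using Suc b by (simp add: N_def)
    qed (use x Dk in auto)
    from this[of _ k] have "lpow b k x \<in> I" if "x \<in> carrier L" for x
      using that D0 by simp
    then show ?thesis
      by (rule nilpotent_of_frattini[OF \<open>fin_dim\<close> subI IF NL[OF b] _ v])
  qed

  \<comment> \<open>The left annihilator of \<open>L\<close> modulo \<open>J\<close> inside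
    \<open>I\<close>. It contains \<open>J\<close>, and it is stable under left multiplications by
    the Leibniz identity.\<close>
  define B where "B = {b \<in> I. \<forall>x\<in>carrier L. b \<otimes> x \<in> J}"
  have subB: "sub B"
    unfolding sub_iff
    using IL sub_zero[OF subI] sub_add[OF subI] sub_smult[OF subI]
      sub_zero[OF subJ] sub_add[OF subJ] sub_smult[OF subJ]
    by (auto simp: B_def mult_add_left mult_smult_left)
  have xB: "x \<otimes> b \<in> B" if x: "x \<in> carrier L" and b: "b \<in> B" for x b
  proof -
    have b': "b \<in> I" "\<And>y. y \<in> carrier L \<Longrightarrow> b \<otimes> y \<in> J"
      using b by (auto simp: B_def)
    have "(x \<otimes> b) \<otimes> y \<in> J" if y: "y \<in> carrier L" for y
      using left_leibniz'[OF x IL[OF b'(1)] y] b' x y ideal_mult_left[OF J x]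
      by (simp add: sub_minus[OF subJ])
    then show ?thesis
      using ideal_mult_left[OF I x b'(1)] by (simp add: B_def)
  qed
  have JB: "J \<subseteq> B"
    using \<open>J \<subset> I\<close> ideal_mult_right[OF J] by (auto simp: B_def)
  \<comment> \<open>Working inside \<open>B\<close> kills the right multiplications modulo \<open>J\<close>; if \<open>B = J\<close>, then \<open>x u + u x \<in> B\<close>
    makes them the negatives of the left ones.\<close>
  define V where "V = (if B = J then I else B)"
  have V: "sub V" "J \<subset> V" "V \<subseteq> I" and xV: "\<And>x v. x \<in> carrier L \<Longrightarrow> v \<in> V \<Longrightarrow> x \<otimes> v \<in> V"
    using subI subB \<open>J \<subset> I\<close> JB xB ideal_mult_left[OF I] by (auto simp: V_def B_def split: if_splits)
  have VL: "\<And>v. v \<in> V \<Longrightarrow> v \<in> carrier L"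
    using IL V(3) by blast

  \<comment> \<open>All products lie in \<open>N\<close>, so they annihilate \<open>W\<close> modulo
    \<open>J\<close>; this is the commutativity that a common eigenvector requires.\<close>
  define W where "W = {v \<in> V. \<forall>b\<in>N. b \<otimes> v \<in> J}"
  obtain v0 where "v0 \<in> V" "v0 \<notin> J" "\<And>b. b \<in> N \<Longrightarrow> b \<otimes> v0 \<in> J"
    by (rule engel[OF \<open>fin_dim\<close> subN LL[OF NL NL] nil subJ V(1,2)
          ideal_mult_left[OF J NL] xV[OF NL]]) auto
  then have "v0 \<in> W" "v0 \<notin> J"
    by (auto simp: W_def)
  moreover have "J \<subseteq> W"
    using V(2) ideal_mult_left[OF J NL] by (auto simp: W_def)
  ultimately have JW: "J \<subset> W"
    by blast
  have subW: "sub W"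
    unfolding sub_iff
    using VL NL sub_zero[OF V(1)] sub_add[OF V(1)] sub_smult[OF V(1)]
      sub_zero[OF subJ] sub_add[OF subJ] sub_smult[OF subJ]
    by (auto simp: W_def mult_add_right mult_smult_right)
  \<comment> \<open>In \<open>b (x w) = (b x) w + x (b w)\<close> the factor \<open>b x\<close> is
    in \<open>N\<close>, as every product is.\<close>
  have xW: "x \<otimes> w \<in> W" if x: "x \<in> carrier L" and w: "w \<in> W" for x w
  proof -
    have w': "w \<in> V" "\<And>b. b \<in> N \<Longrightarrow> b \<otimes> w \<in> J"
      using w by (auto simp: W_def)
    have "b \<otimes> (x \<otimes> w) \<in> J" if b: "b \<in> N" for b
      using left_leibniz[OF NL[OF b] x VL[OF w'(1)]] w'(2)[OF LL[OF NL[OF b] x]]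
        ideal_mult_left[OF J x w'(2)[OF b]] by (simp add: sub_add[OF subJ])
    then show ?thesis
      using xV[OF x w'(1)] by (simp add: W_def)
  qed
  have comm: "(x \<otimes> y) \<otimes> w \<in> J" if "x \<in> carrier L" "y \<in> carrier L" "w \<in> W" for x y w
    using that LL by (auto simp: W_def)
  obtain u where u: "u \<in> W" "u \<notin> J" and eig: "\<And>x. x \<in> carrier L \<Longrightarrow> \<exists>c. x \<otimes> u \<ominus> c \<odot> u \<in> J"
    using common_eigenvector_exists[OF alg_closed \<open>fin_dim\<close> subJ subW JW ideal_mult_left[OF J] xW comm]
    by blast
  have uV: "u \<in> V" and uI: "u \<in> I" and uL: "u \<in> carrier L"
    using u V(3) IL by (auto simp: W_def)
  define A where "A = adjoin J u"
  have subA: "sub A" and JA: "J \<subseteq> A" and uA: "u \<in> A"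
    using adjoin_sub adjoin_superset adjoin_mem subJ uL by (auto simp: A_def)
  have xu: "x \<otimes> u \<in> A" if x: "x \<in> carrier L" for x
  proof -
    obtain c where c: "x \<otimes> u \<ominus> c \<odot> u \<in> J"
      using eig[OF x] by blast
    have "x \<otimes> u = (x \<otimes> u \<ominus> c \<odot> u) \<oplus> c \<odot> u"
      using x uL by (simp add: M.minus_eq M.a_assoc M.l_neg)
    then show ?thesis
      using c unfolding A_def adjoin_def by blast
  qed
  \<comment> \<open>If \<open>B \<noteq> J\<close>, then \<open>u \<in> B\<close> and so
    \<open>u x \<in> J\<close>. Otherwise \<open>x u + u x\<close> lies in \<open>B = J\<close>, and
    \<open>x u \<in> A\<close> is known.\<close>
  have ux: "u \<otimes> x \<in> A" if x: "x \<in> carrier L" for x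
  proof (cases "B = J")
    case False
    then show ?thesis
      using uV x JA by (auto simp: V_def B_def)
  next
    case True
    have "x \<otimes> u \<oplus> u \<otimes> x \<in> I"
      using ideal_mult_left[OF I x uI] ideal_mult_right[OF I x uI] by (rule sub_add[OF subI])
    then have "x \<otimes> u \<oplus> u \<otimes> x \<in> B"
      using square_sum_mult[OF x uL] sub_zero[OF subJ] by (simp add: B_def)
    then have "x \<otimes> u \<oplus> u \<otimes> x \<in> A"
      using True JA by blast
    then show ?thesis
      using sub_add_cancel[OF subA xu[OF x], of "u \<otimes> x"] x uL by simp
  qed
  have "leibniz_ideal A L"
    unfolding leibniz_ideal_def
  proof (intro conjI ballI)
    fix x y assume x: "x \<in> carrier L" and "y \<in> A"
    then obtain j c where j: "j \<in> J" "y = j \<oplus> c \<odot> u"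
      by (auto simp: A_def adjoin_def)
    have jL: "j \<in> carrier L"
      using sub_carrier[OF subJ j(1)] .
    show "x \<otimes> y \<in> A"
      using x j uL jL ideal_mult_left[OF J x j(1)] JA xu[OF x]
      by (auto simp: mult_add_right mult_smult_right intro!: sub_add[OF subA] sub_smult[OF subA])
    show "y \<otimes> x \<in> A"
      using x j uL jL ideal_mult_right[OF J x j(1)] JA ux[OF x]
      by (auto simp: mult_add_left mult_smult_left intro!: sub_add[OF subA] sub_smult[OF subA])
  qed (rule subA)
  then show thesis
    using that[of u] uI u(2) by (simp add: A_def)
qed

text \<open>Among the ideals inside \<open>I\<close> that a flag from zero reaches, a maximal one
  must be \<open>I\<close>, since \<open>ideal_extension_exists\<close> enlarges any smaller one.
  Its flag is then glued to the preimage of the flag of \<open>L/I\<close>.\<close>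

lemma supersolvable_of_frattini_quotient:
  assumes alg_closed: "\<And>p :: 'k poly. degree p > 0 \<Longrightarrow> \<exists>z. poly p z = 0"
    and fin_dim and I: "leibniz_ideal I L" and IF: "I \<subseteq> frattini L"
    and ss: "supersolvable (leibniz_quot L I)"
  shows "supersolvable L"
proof -
  obtain k D where D: "ideal_flag I (carrier L) k D"
    using quotient_flag_exists[OF I ss] .
  define Q where "Q J \<longleftrightarrow> J \<subseteq> I \<and> (\<exists>k C. ideal_flag {\<zero>} J k C)" for J
  have Q_ideal: "leibniz_ideal J L" if "Q J" for J
    using that by (auto simp: Q_def ideal_flag_def)
  have "leibniz_ideal {\<zero>} L"
    by (auto simp: leibniz_ideal_def sub_iff)
  then have "ideal_flag {\<zero>} {\<zero>} 0 (\<lambda>_. {\<zero>})"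
    by (simp add: ideal_flag_def)
  then have Q0: "Q {\<zero>}"
    using sub_zero[OF ideal_sub[OF I]] by (auto simp: Q_def)
  obtain J where J: "Q J" and max: "\<And>T. Q T \<Longrightarrow> J \<subseteq> T \<Longrightarrow> T = J"
    by (rule maximal_subspace_exists[OF \<open>fin_dim\<close>, of Q "{\<zero>}"]) (rule Q0 ideal_sub Q_ideal | blast)+
  obtain k' C where C: "ideal_flag {\<zero>} J k' C"
    using J by (auto simp: Q_def)
  have "J = I"
  proof (rule ccontr)
    assume "J \<noteq> I"
    then have "J \<subset> I"
      using J by (auto simp: Q_def)
    then obtain u where u: "u \<in> I" "u \<notin> J" "leibniz_ideal (adjoin J u) L"
      using ideal_extension_exists[OF alg_closed \<open>fin_dim\<close> I IF D Q_ideal[OF J]] by blast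
    have uL: "u \<in> carrier L"
      using sub_carrier[OF ideal_sub[OF I] u(1)] .
    have "Q (adjoin J u)"
      using ideal_flag_extend[OF C uL u(2,3)] adjoin_least[OF ideal_sub[OF I] _ u(1), of J] \<open>J \<subset> I\<close>
      unfolding Q_def by blast
    then have "adjoin J u = J"
      using adjoin_superset[OF ideal_sub[OF Q_ideal[OF J]] uL] by (rule max)
    then show False
      using u(2) adjoin_mem[OF ideal_sub[OF Q_ideal[OF J]] uL] by simp
  qed
  then show ?thesis
    using ideal_flag_trans[OF C] D supersolvable_iff_flag by blast
qed

end

theorem theorem5p1:
  fixes L :: "('k::alg_closed_field, 'a) module" and I :: "'a set"
  assumes "leibniz_algebra L"
    and "vectorspace.fin_dim class_ring L"
    and "leibniz_ideal I L"
    and "I \<subseteq> frattini L"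
    and "supersolvable (leibniz_quot L I)"
  shows "supersolvable L"
  using leibniz_algebra.supersolvable_of_frattini_quotient[OF assms(1) alg_closed_imp_poly_has_root assms(2-)] .

end
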